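(* For every $r \in \left(\frac{1}{2}, \frac{1}{\sqrt{2}}\right)$ there exists a function $\delta(n) = \delta(n,r)$ with $\delta(n) \to 0$ as $n \to \infty$ such that for every $n \in \mathbb{N}$, $$\chi(S_r^{n-1}) \ge \left(2\left(\frac{1}{8r^2}\right)^{\frac{1}{8r^2}}\left(1-\frac{1}{8r^2}\right)^{1-\frac{1}{8r^2}} + \delta(n)\right)^n.$$
   Context: $S_r^{n-1} = \{x \in \mathbb{R}^n : \|x\|_2 = r\}$ denotes the Euclidean sphere of radius $r$ in $\mathbb{R}^n$. Its chromatic number $\chi(S_r^{n-1})$ is the minimum number $k$ of colours such that $S_r^{n-1}$ can be partitioned into $k$ sets none of which contains two points at Euclidean distance exactly $1$. *)

theory Defs
  imports "HOL-Analysis.Analysis"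
begin

(* The dimension n varies inside the statement, so R^n is topspace (Euclidean_space n),
   the sequences vanishing from index n on.  The norm is L2_set over {..<n}; the type-class
   metric on nat => real is a different one.  Note that (euclid_sphere n r) is the sphere
   of radius r in R^n, of topological dimension n - 1. *)
definition euclid_sphere :: "nat \<Rightarrow> real \<Rightarrow> (nat \<Rightarrow> real) set" where
  "euclid_sphere n r = {x \<in> topspace (Euclidean_space n). L2_set x {..<n} = r}"

definition euclid_dist :: "nat \<Rightarrow> (nat \<Rightarrow> real) \<Rightarrow> (nat \<Rightarrow> real) \<Rightarrow> real" where
  "euclid_dist n x y = L2_set (\<lambda>i. x i - y i) {..<n}"

definition unit_distance_free :: "nat \<Rightarrow> (nat \<Rightarrow> real) set \<Rightarrow> bool" where
  "unit_distance_free n A \<longleftrightarrow> (\<forall>x\<in>A. \<forall>y\<in>A. euclid_dist n x y \<noteq> 1)"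

(* An infimum in enat is attained whenever the set is nonempty, so this is the minimum
   number of parts; it would be \<infinity> if there were no finite partition of this kind. *)
definition sphere_chromatic_number :: "nat \<Rightarrow> real \<Rightarrow> enat" where
  "sphere_chromatic_number n r =
     Inf {enat (card P) |P. finite P \<and> partition_on (euclid_sphere n r) P
                            \<and> (\<forall>A\<in>P. unit_distance_free n A)}"

end

(* Analytic part: the logarithmic derivative of (s - 1) zeta(s) extends past Re s = 1, so the sums of
   (Lambda(n) - 1) n^(-sigma) against Fejer kernels in ln n - y are O(1/y) uniformly for 1 < sigma <= 2.
   A fixed kernel bounds the mass of Lambda near y from above; a very narrow one then shows that
   the intervals [exp (y - eta), exp (y + eta)] contain prime powers for all large y.

   Combinatorial part: on {-c, c}^m with c^2 = 1/(8q), embedded in the sphere with one coordinate to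
   spare, distance 1 means Hamming distance 2q.  For a prime power q with m < 4q, the linear algebra
   bound of Frankl and Wilson shows that a set of even-weight cube points avoiding this distance has at most
   sum_(i<q) (m choose i) elements.  With q/m tending to 1/(8r^2) from above, the entropy
   bound for this sum gives the claim. *)
theory Submission
  imports Defs "HOL-Complex_Analysis.Complex_Analysis" "HOL-Number_Theory.Prime_Powers"
    "HOL-Real_Asymp.Real_Asymp"
begin

section \<open>Dirichlet series\<close>

text \<open>The rate is reached for every n only if q/m can be brought arbitrarily close to
  1/(8r^2). A Bertrand-type choice of q would lose an exponential factor; prime powers in
  [x, (1 + eps) x] for all large x are required, and this density comes from the absence of zeros of
  zeta on Re s = 1. Prime powers serve the combinatorial half as well as primes do, and they are
  exactly the support of Lambda. Since a Fejer kernel has compactly supported Fourier transform,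
  continuity of the extended function on a bounded piece of the line Re s = 1 is enough.

  The ratio approaches its limit from above because the cube fits into the sphere only for m \<le> 8
  r^2 q. The range of r puts the limit between 1/4 and 1/2: above 1/4, 2q is the only positive
  multiple of 2q up to m; below 1/2, the binomial sum is exponentially smaller than 2^m. Even weight
  makes all distances even, so a polynomial of degree q - 1 in half the distance suffices; the lost
  factor 2 disappears in the n-th root.\<close>

definition dirichlet_series :: "(nat \<Rightarrow> complex) \<Rightarrow> complex \<Rightarrow> complex" where
  "dirichlet_series c s = (\<Sum>n. c n * of_nat n powr (-s))"

text \<open>Tested on the real axis only, because the norm of \<open>n powr (-s)\<close> depends on
  Re s alone. Index 0 contributes nothing, since \<open>0 powr z = 0\<close>.\<close>

definition abs_conv_right_of_1 :: "(nat \<Rightarrow> complex) \<Rightarrow> bool" where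
  "abs_conv_right_of_1 c \<longleftrightarrow> (\<forall>\<sigma>>1. summable (\<lambda>n. norm (c n) * real n powr (-\<sigma>)))"

lemma norm_of_nat_powr: "norm (of_nat n powr s :: complex) = real n powr Re s"
  by (cases "n = 0") (auto simp: norm_powr_real_powr)

lemma norm_summable_dirichlet_series:
  assumes "abs_conv_right_of_1 c" "Re s > 1"
  shows "summable (\<lambda>n. norm (c n * of_nat n powr (-s)))"
  using assms by (simp add: abs_conv_right_of_1_def norm_mult norm_of_nat_powr)

lemma dirichlet_series_sums:
  assumes "abs_conv_right_of_1 c" "Re s > 1"
  shows "(\<lambda>n. c n * of_nat n powr (-s)) sums dirichlet_series c s"
  unfolding dirichlet_series_def
  by (intro summable_sums summable_norm_cancel[OF norm_summable_dirichlet_series[OF assms]])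

lemma has_field_derivative_of_nat_powr:
  "((\<lambda>s. of_nat n powr (-s) :: complex) has_field_derivative - (of_real (ln (real n)) * of_nat n powr (-s))) (at s within S)"
proof (cases "n = 0")
  case False
  then have n: "(of_nat n :: complex) \<noteq> 0" by simp
  have "((\<lambda>s. of_nat n powr (-s) :: complex) has_field_derivative (Ln (of_nat n) * of_nat n powr (-s)) * (-1)) (at s within S)"
    by (rule DERIV_chain2[OF has_field_derivative_powr_right[OF n]]) (auto intro!: derivative_eq_intros)
  then show ?thesis using False by (simp add: Ln_of_nat)
qed auto

text \<open>A disc of half the distance to the line Re = 1 stays in Re \<ge> 1 + d, where the series
  at 1 + d dominates; this justifies termwise differentiation.\<close>

lemma dirichlet_series_deriv:
  assumes c: "abs_conv_right_of_1 c" and s: "Re s > 1"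
  shows "(dirichlet_series c has_field_derivative
           - dirichlet_series (\<lambda>n. c n * of_real (ln (real n))) s) (at s)"
proof -
  let ?S = "{s. Re s > 1}"
  have o: "open ?S" by (simp add: open_halfspace_Re_gt)
  have "\<exists>g g'. \<forall>x \<in> ?S. ((\<lambda>n. c n * of_nat n powr (-x)) sums g x) \<and>
      ((\<lambda>n. - (c n * of_real (ln (real n)) * of_nat n powr (-x))) sums g' x) \<and> (g has_field_derivative g' x) (at x)"
  proof (rule series_and_derivative_comparison_complex[OF o])
    fix n x assume "x \<in> ?S"
    show "((\<lambda>x. c n * of_nat n powr - x) has_field_derivative
            - (c n * of_real (ln (real n)) * of_nat n powr - x)) (at x)"
      using DERIV_cmult[OF has_field_derivative_of_nat_powr[where n = n and s = x and S = UNIV], of "c n"] by (simp add: mult_ac)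
  next
    fix x assume x: "x \<in> ?S"
    define d where "d = (Re x - 1) / 2"
    have d: "d > 0" "1 + d > 1" using x by (auto simp: d_def)
    define h :: "nat \<Rightarrow> complex" where "h n = of_real (norm (c n) * real n powr (-(1 + d)))" for n
    have "summable h"
      unfolding h_def using c[unfolded abs_conv_right_of_1_def, rule_format, OF d(2)] by (rule summable_of_real)
    moreover have "range h \<subseteq> \<real>\<^sub>\<ge>\<^sub>0" by (auto simp: h_def)
    moreover have "norm (c n * of_nat n powr - y) \<le> norm (h n)" if "y \<in> ball x d \<inter> ?S" for n y
    proof (cases "n = 0")
      case False
      have "\<bar>Re (x - y)\<bar> \<le> norm (x - y)" by (rule abs_Re_le_cmod)
      then have "Re y \<ge> 1 + d" using that unfolding d_def by (auto simp: dist_norm field_simps)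
      then show ?thesis using False
        by (auto simp: h_def norm_mult norm_of_nat_powr intro!: mult_left_mono powr_mono)
    qed (auto simp: h_def)
    ultimately show "\<exists>d h. 0 < d \<and> summable h \<and> range h \<subseteq> \<real>\<^sub>\<ge>\<^sub>0 \<and>
        (\<forall>\<^sub>F n in sequentially. \<forall>y\<in>ball x d \<inter> ?S. cmod (c n * of_nat n powr - y) \<le> cmod (h n))"
      using d by (intro exI[of _ d] exI[of _ h]) auto
  qed
  then obtain g g' where g: "\<And>x. x \<in> ?S \<Longrightarrow> (\<lambda>n. c n * of_nat n powr (-x)) sums g x"
    "\<And>x. x \<in> ?S \<Longrightarrow> (\<lambda>n. - (c n * of_real (ln (real n)) * of_nat n powr (-x))) sums g' x"
    "\<And>x. x \<in> ?S \<Longrightarrow> (g has_field_derivative g' x) (at x)" by blast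
  have gd: "g x = dirichlet_series c x" if "x \<in> ?S" for x
    using g(1)[OF that] by (simp add: dirichlet_series_def sums_iff)
  have g'd: "g' s = - dirichlet_series (\<lambda>n. c n * of_real (ln (real n))) s"
    using sums_minus[OF g(2)[of s]] s by (simp add: dirichlet_series_def sums_iff)
  show ?thesis
    using has_field_derivative_transform_within_open[OF g(3)[of s] o _ gd] s g'd by simp
qed

lemma abs_conv_right_of_1_const: "abs_conv_right_of_1 (\<lambda>_. 1)"
  by (auto simp: abs_conv_right_of_1_def summable_real_powr_iff)

text \<open>Half of the excess \<sigma> - 1 pays for the logarithm, the other half keeps the series
  convergent.\<close>

lemma abs_conv_right_of_1_mult_ln:
  assumes "abs_conv_right_of_1 c"
  shows "abs_conv_right_of_1 (\<lambda>n. c n * of_real (ln (real n)))"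
  unfolding abs_conv_right_of_1_def
proof (intro allI impI)
  fix \<sigma> :: real assume \<sigma>: "\<sigma> > 1"
  define e where "e = (\<sigma> - 1) / 2"
  have e: "e > 0" "1 + e > 1" using \<sigma> by (auto simp: e_def)
  have "summable (\<lambda>n. norm (c n) * real n powr (-(1+e)) / e)"
    using assms[unfolded abs_conv_right_of_1_def, rule_format, OF e(2)] by (rule summable_divide)
  then show "summable (\<lambda>n. norm (c n * of_real (ln (real n))) * real n powr (-\<sigma>))"
  proof (rule summable_comparison_test'[where N = 1])
    fix n :: nat assume n: "n \<ge> 1"
    have "ln (real n) \<le> real n powr e / e" using ln_powr_bound[of "real n" e] n e by simp
    then have "norm (c n) * ln (real n) * real n powr (-\<sigma>) \<le> norm (c n) * (real n powr e / e) * real n powr (-\<sigma>)"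
      by (intro mult_left_mono mult_right_mono) auto
    also have "\<dots> = norm (c n) * (real n powr e * real n powr (-\<sigma>)) / e" by simp
    also have "real n powr e * real n powr (-\<sigma>) = real n powr (-(1+e))"
      unfolding powr_add[symmetric] by (rule arg_cong[of _ _ "\<lambda>x. real n powr x"]) (simp add: e_def field_simps)
    finally show "norm (norm (c n * of_real (ln (real n))) * real n powr (-\<sigma>)) \<le> norm (c n) * real n powr (-(1+e)) / e"
      using n by (simp add: norm_mult)
  qed
qed

lemma abs_conv_right_of_1_mono:
  assumes "abs_conv_right_of_1 c" "\<And>n. n > 0 \<Longrightarrow> norm (b n) \<le> norm (c n)"
  shows "abs_conv_right_of_1 b"
  unfolding abs_conv_right_of_1_def
proof (intro allI impI)
  fix \<sigma> :: real assume \<sigma>: "\<sigma> > 1"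
  then have "summable (\<lambda>n. norm (c n) * real n powr (-\<sigma>))"
    using assms by (auto simp: abs_conv_right_of_1_def)
  then show "summable (\<lambda>n. norm (b n) * real n powr (-\<sigma>))"
    by (rule summable_comparison_test'[where N = 1]) (auto intro!: mult_right_mono assms)
qed

text \<open>An absolutely convergent double sum over pairs (d, k) of positive integers is regrouped
  by n = d k. Index 0, which has infinitely many divisors, is kept apart; its terms vanish.\<close>

lemma dirichlet_series_mult:
  assumes a: "abs_conv_right_of_1 a" and b: "abs_conv_right_of_1 b" and s: "Re s > 1"
    and conv: "\<And>n. n > 0 \<Longrightarrow> (\<Sum>d | d dvd n. a d * b (n div d)) = c n"
  shows "dirichlet_series a s * dirichlet_series b s = dirichlet_series c s"
proof -
  let ?A = "{0<..} :: nat set"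
  define u where "u c n = c n * (of_nat n powr (-s) :: complex)" for c :: "nat \<Rightarrow> complex" and n
  have u0: "u c 0 = 0" for c by (simp add: u_def)
  have abs: "(\<lambda>n. norm (u c n)) summable_on ?A" and hs: "(u c has_sum dirichlet_series c s) ?A"
    if "abs_conv_right_of_1 c" for c
  proof -
    have n: "summable (\<lambda>n. norm (u c n))" unfolding u_def using norm_summable_dirichlet_series[OF that s] .
    have "(u c has_sum dirichlet_series c s) UNIV"
      using dirichlet_series_sums[OF that s] by (intro norm_summable_imp_has_sum[OF n]) (simp add: u_def[abs_def])
    then show "(u c has_sum dirichlet_series c s) ?A"
      by (subst (asm) has_sum_cong_neutral[where S = UNIV and T = ?A and g = "u c"]) (auto simp: u0)
    have "(\<lambda>n. norm (u c n)) summable_on UNIV" using norm_summable_imp_summable_on[of "\<lambda>n. norm (u c n)"] n by simp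
    then show "(\<lambda>n. norm (u c n)) summable_on ?A" by (rule summable_on_subset_banach) auto
  qed
  have "(\<lambda>x. norm ((\<lambda>(d,k). u a d * u b k) x)) summable_on ?A \<times> ?A"
    unfolding Infinite_Sum.abs_summable_on_Sigma_iff
    using abs[OF a] abs[OF b]
    by (auto simp: norm_mult abs_mult infsum_nonneg infsum_cmult_right' intro!: summable_on_cmult_right summable_on_cmult_left)
  then have "(\<lambda>(d,k). u a d * u b k) summable_on ?A \<times> ?A" by (rule abs_summable_summable)
  then have "((\<lambda>(d,k). u a d * u b k) has_sum infsum (\<lambda>(d,k). u a d * u b k) (?A \<times> ?A)) (?A \<times> ?A)"
    by (rule has_sum_infsum)
  moreover have "((\<lambda>d. u a d * dirichlet_series b s) has_sum infsum (\<lambda>(d,k). u a d * u b k) (?A \<times> ?A)) ?A"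
    by (rule has_sum_SigmaD[OF calculation]) (auto intro!: has_sum_cmult_right hs b)
  moreover have "((\<lambda>d. u a d * dirichlet_series b s) has_sum (dirichlet_series a s * dirichlet_series b s)) ?A"
    by (intro has_sum_cmult_left hs a)
  ultimately have "((\<lambda>(d,k). u a d * u b k) has_sum (dirichlet_series a s * dirichlet_series b s)) (?A \<times> ?A)"
    by (metis has_sum_unique)
  also have "?this \<longleftrightarrow> ((\<lambda>(n,d). u a d * u b (n div d)) has_sum (dirichlet_series a s * dirichlet_series b s))
      (Sigma ?A (\<lambda>n. {d. d dvd n}))"
    by (rule has_sum_reindex_bij_witness[of _ "\<lambda>(n,d). (d, n div d)" "\<lambda>(d,k). (d * k, d)"])
       (auto simp: dvd_div_eq_0_iff intro!: Nat.gr0I)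
  finally have "((\<lambda>n. \<Sum>d | d dvd n. u a d * u b (n div d)) has_sum (dirichlet_series a s * dirichlet_series b s)) ?A"
    by (rule has_sum_SigmaD) (auto intro!: has_sum_finite)
  also have "?this \<longleftrightarrow> (u c has_sum (dirichlet_series a s * dirichlet_series b s)) UNIV"
  proof (rule has_sum_cong_neutral)
    fix n assume n: "n \<in> ?A \<inter> UNIV"
    have "(\<Sum>d | d dvd n. u a d * u b (n div d)) = (\<Sum>d | d dvd n. a d * b (n div d) * of_nat n powr (-s))"
    proof (intro sum.cong refl)
      fix d assume "d \<in> {d. d dvd n}"
      then obtain k where k: "n = d * k" by auto
      have "of_nat n powr (-s) = of_nat d powr (-s) * (of_nat k powr (-s) :: complex)"
        unfolding k of_nat_mult by (rule powr_times_real) auto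
      with k n show "u a d * u b (n div d) = a d * b (n div d) * of_nat n powr (-s)"
        by (auto simp: u_def)
    qed
    also have "\<dots> = u c n" using conv[of n] n by (simp add: sum_distrib_right[symmetric] u_def)
    finally show "(\<Sum>d | d dvd n. u a d * u b (n div d)) = u c n" .
  qed (auto simp: u0)
  finally have "u c sums (dirichlet_series a s * dirichlet_series b s)" by (rule has_sum_imp_sums)
  then have "suminf (u c) = dirichlet_series a s * dirichlet_series b s" by (simp add: sums_iff)
  moreover have "suminf (u c) = dirichlet_series c s" by (simp add: u_def[abs_def] dirichlet_series_def)
  ultimately show ?thesis by simp
qed

section \<open>The von Mangoldt series and the logarithmic derivative of zeta\<close>

lemma mangoldt_nonneg: "(mangoldt n :: real) \<ge> 0"
proof (cases "primepow n")
  case True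
  then obtain p k where "prime p" "n = p ^ k" by (auto simp: primepow_def)
  then show ?thesis using prime_ge_1_nat[of p] by (simp add: mangoldt_primepow)
qed (simp add: mangoldt_def)

lemma mangoldt_le_ln:
  assumes "n > 0" shows "(mangoldt n :: real) \<le> ln (real n)"
proof -
  have "(mangoldt n :: real) \<le> (\<Sum>d | d dvd n. mangoldt d)"
    using assms by (intro member_le_sum) (auto simp: mangoldt_nonneg)
  then show ?thesis using assms by (simp add: mangoldt_sum)
qed

lemma norm_mangoldt: "norm (mangoldt n :: complex) = mangoldt n"
  by (metis norm_of_real abs_of_nonneg mangoldt_nonneg of_real_mangoldt)

lemma abs_conv_right_of_1_mangoldt: "abs_conv_right_of_1 mangoldt"
proof (rule abs_conv_right_of_1_mono[OF abs_conv_right_of_1_mult_ln[OF abs_conv_right_of_1_const]])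
  fix n :: nat assume "n > 0"
  then show "norm (mangoldt n :: complex) \<le> norm (1 * of_real (ln (real n)) :: complex)"
    using mangoldt_le_ln[of n] mangoldt_nonneg[of n] by (simp add: norm_mangoldt)
qed

lemma mangoldt_times_zeta:
  assumes "Re s > 1"
  shows "dirichlet_series mangoldt s * dirichlet_series (\<lambda>_. 1) s = dirichlet_series (\<lambda>n. of_real (ln (real n))) s"
  by (rule dirichlet_series_mult[OF abs_conv_right_of_1_mangoldt abs_conv_right_of_1_const assms])
     (simp add: mangoldt_sum)

text \<open>The coefficients ln n of -zeta' are the Dirichlet convolution of Lambda with 1. The
  product form avoids dividing by zeta before its zeros are excluded.\<close>

lemma zeta_deriv:
  assumes "Re s > 1"
  shows "(dirichlet_series (\<lambda>_. 1) has_field_derivative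
           - (dirichlet_series mangoldt s * dirichlet_series (\<lambda>_. 1) s)) (at s)"
  using dirichlet_series_deriv[OF abs_conv_right_of_1_const assms] mangoldt_times_zeta[OF assms] by simp

section \<open>Non-vanishing of the zeta function on the line Re s = 1\<close>

abbreviation zeta_series :: "complex \<Rightarrow> complex" where
  "zeta_series \<equiv> dirichlet_series (\<lambda>_. 1)"

abbreviation mangoldt_series :: "complex \<Rightarrow> complex" where
  "mangoldt_series \<equiv> dirichlet_series mangoldt"

(* Summed over n this telescopes to (s - 1) zeta(s) when Re s > 1.  Because 0 powr z = 0, the term
   for n = 0 is the constant 1. *)
definition zeta_reg_term :: "nat \<Rightarrow> complex \<Rightarrow> complex" where
  "zeta_reg_term n s = (s - 1) * of_nat n powr (-s) - of_nat n powr (1 - s) + of_nat (Suc n) powr (1 - s)"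

definition zeta_reg :: "complex \<Rightarrow> complex" where
  "zeta_reg s = (\<Sum>n. zeta_reg_term n s)"

text \<open>The term is the remainder of the first-order Taylor expansion of z^(1 - s) at z = n,
  taken at n + 1. The second derivative supplies the extra power of n that moves convergence from Re
  s > 1 to Re s > 0.\<close>

lemma norm_zeta_reg_term_le:
  assumes n: "n > 0" and s: "Re s > 0"
  shows "norm (zeta_reg_term n s) \<le> norm (s - 1) * norm s * real n powr (-Re s - 1)"
proof -
  define f :: "nat \<Rightarrow> complex \<Rightarrow> complex" where
    "f i z = (if i = 0 then z powr (1 - s) else if i = 1 then (1 - s) * z powr (-s)
              else (1 - s) * (-s) * z powr (-s - 1))" for i z
  let ?S = "closed_segment (of_nat n) (of_nat (Suc n)) :: complex set"
  let ?B = "norm (s - 1) * norm s * real n powr (-Re s - 1)"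
  have S: "z \<in> \<real> \<and> Re z \<ge> real n" if "z \<in> ?S" for z
  proof -
    have "?S = closed_segment (of_real (real n)) (of_real (real (Suc n)))" by simp
    also have "\<dots> = of_real ` closed_segment (real n) (real (Suc n))" by (rule closed_segment_of_real)
    finally show ?thesis using that by (auto simp: closed_segment_eq_real_ivl)
  qed
  have "cmod (f 0 (of_nat (Suc n)) - (\<Sum>i\<le>1. f i (of_nat n) * (of_nat (Suc n) - of_nat n) ^ i / (fact i)))
      \<le> ?B * cmod (of_nat (Suc n) - of_nat n) ^ (Suc 1) / fact 1"
  proof (rule complex_Taylor)
    fix i x assume x: "x \<in> ?S" and i: "i \<le> (1::nat)"
    have x': "x \<notin> \<real>\<^sub>\<le>\<^sub>0" using S[OF x] n by (auto simp: complex_nonpos_Reals_iff)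
    show "(f i has_field_derivative f (Suc i) x) (at x within ?S)"
    proof (cases "i = 0")
      case True
      then show ?thesis using x' unfolding f_def
        by (auto intro!: derivative_eq_intros has_field_derivative_powr)
    next
      case False
      then have "i = 1" using i by auto
      then show ?thesis using x' unfolding f_def
        by (auto intro!: derivative_eq_intros has_field_derivative_powr)
    qed
  next
    fix x assume x: "x \<in> ?S"
    have "norm (x powr (-s - 1)) = Re x powr (-Re s - 1)"
      using S[OF x] n by (subst norm_powr_real_powr) auto
    also have "\<dots> \<le> real n powr (-Re s - 1)"
      using S[OF x] n s by (intro powr_mono2') auto
    finally show "cmod (f (Suc 1) x) \<le> ?B"
      by (auto simp: f_def norm_mult norm_minus_commute intro!: mult_left_mono)
  qed auto
  also have "f 0 (of_nat (Suc n)) - (\<Sum>i\<le>1. f i (of_nat n) * (of_nat (Suc n) - of_nat n) ^ i / (fact i)) = zeta_reg_term n s"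
    by (simp add: f_def zeta_reg_term_def algebra_simps)
  finally show ?thesis by simp
qed

lemma zeta_reg_term_holomorphic: "zeta_reg_term n holomorphic_on A"
proof -
  have "(\<lambda>s. of_nat m powr (a - s) :: complex) holomorphic_on A" for m a
    by (cases "m = 0") (auto intro!: holomorphic_intros)
  from this[of n 0] this[of n 1] this[of "Suc n" 1] show ?thesis
    unfolding zeta_reg_term_def by (auto intro!: holomorphic_intros simp del: of_nat_Suc)
qed

lemma zeta_reg_holomorphic: "zeta_reg holomorphic_on {s. Re s > 0}"
proof -
  let ?S = "{s. Re s > 0}"
  have o: "open ?S" by (simp add: open_halfspace_Re_gt)
  have "\<exists>g. \<forall>x \<in> ?S. ((\<lambda>n. zeta_reg_term n x) sums g x) \<and> g field_differentiable (at x)"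
  proof (rule series_differentiable_comparison_complex[OF o])
    fix n x assume "x \<in> ?S"
    show "zeta_reg_term n field_differentiable (at x)"
      using zeta_reg_term_holomorphic[of n UNIV] by (simp add: holomorphic_on_def)
  next
    fix x assume x: "x \<in> ?S"
    define d where "d = Re x / 2"
    define M where "M = (norm x + d + 1)\<^sup>2"
    define h :: "nat \<Rightarrow> complex" where "h n = of_real (M * real n powr (-(1 + d)))" for n
    have d: "d > 0" using x by (simp add: d_def)
    have "summable (\<lambda>n. real n powr (-(1 + d)))"
      using d by (subst summable_real_powr_iff) auto
    then have "summable h"
      unfolding h_def by (intro summable_of_real summable_mult)
    moreover have "h n \<in> \<real>\<^sub>\<ge>\<^sub>0" for n
      unfolding h_def nonneg_Reals_of_real_iff by (simp add: M_def)
    then have "range h \<subseteq> \<real>\<^sub>\<ge>\<^sub>0" by auto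
    moreover have "norm (zeta_reg_term n y) \<le> norm (h n)" if n: "n > 0" and y: "y \<in> ball x d \<inter> ?S" for n y
    proof -
      have "\<bar>Re (x - y)\<bar> \<le> norm (x - y)" by (rule abs_Re_le_cmod)
      then have Rey: "Re y \<ge> d" using y unfolding d_def by (auto simp: dist_norm field_simps)
      have ny: "norm y \<le> norm x + d"
        using norm_triangle_ineq2[of y x] y by (auto simp: dist_norm norm_minus_commute)
      then have ny1: "norm (y - 1) \<le> norm x + d + 1"
        using norm_triangle_ineq4[of y 1] by simp
      have "norm (zeta_reg_term n y) \<le> norm (y - 1) * norm y * real n powr (-Re y - 1)"
        using norm_zeta_reg_term_le[OF n] y by auto
      also have "\<dots> \<le> M * real n powr (-(1 + d))"
        unfolding M_def power2_eq_square
        using ny ny1 n Rey d by (intro mult_mono powr_mono) auto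
      also have "\<dots> = norm (h n)" unfolding h_def norm_of_real by (simp add: M_def)
      finally show ?thesis .
    qed
    ultimately show "\<exists>d h. 0 < d \<and> summable h \<and> range h \<subseteq> \<real>\<^sub>\<ge>\<^sub>0 \<and>
        (\<forall>\<^sub>F n in sequentially. \<forall>y\<in>ball x d \<inter> ?S. cmod (zeta_reg_term n y) \<le> cmod (h n))"
      using d by (intro exI[of _ d] exI[of _ h] conjI eventually_mono[OF eventually_gt_at_top[of 0]]) auto
  qed blast
  then obtain g where g: "\<And>x. x \<in> ?S \<Longrightarrow> (\<lambda>n. zeta_reg_term n x) sums g x"
    "\<And>x. x \<in> ?S \<Longrightarrow> g field_differentiable (at x)" by blast
  have "g holomorphic_on ?S"
    using g(2) by (auto simp: holomorphic_on_def intro: field_differentiable_at_within)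
  moreover have "g x = zeta_reg x" if "x \<in> ?S" for x
    using g(1)[OF that] by (simp add: zeta_reg_def sums_iff)
  ultimately show ?thesis by (rule holomorphic_transform)
qed

text \<open>This is the residue of zeta at its pole. It comes entirely from the term for n = 0,
  where \<open>0 powr 0 = 0\<close> leaves 1.\<close>

lemma zeta_reg_1: "zeta_reg 1 = 1"
proof -
  have "zeta_reg_term n 1 = (if n = 0 then 1 else 0)" for n
    by (auto simp: zeta_reg_term_def simp del: of_nat_Suc)
  then have "(\<lambda>n. zeta_reg_term n 1) sums 1"
    using sums_If_finite_set[of "{0}" "\<lambda>_. 1 :: complex"] by simp
  then show ?thesis by (simp add: zeta_reg_def sums_iff)
qed

lemma zeta_reg_eq:
  assumes s: "Re s > 1"
  shows "zeta_reg s = (s - 1) * zeta_series s"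
proof -
  have "(\<lambda>n. of_nat n powr (1 - s) :: complex) \<longlonglongrightarrow> 0"
  proof (rule tendsto_norm_zero_cancel)
    have "(\<lambda>n. real n powr (Re (1 - s))) \<longlonglongrightarrow> 0"
      using s by (intro tendsto_neg_powr filterlim_real_sequentially) auto
    then show "(\<lambda>n. norm (of_nat n powr (1 - s) :: complex)) \<longlonglongrightarrow> 0"
      by (simp add: norm_of_nat_powr)
  qed
  \<comment> \<open>The limit and the initial value \<open>0 powr (1 - s)\<close> are both 0, so the
    telescoping part contributes nothing.\<close>
  from telescope_sums[OF this]
  have "(\<lambda>n. of_nat (Suc n) powr (1 - s) - of_nat n powr (1 - s) :: complex) sums 0" by simp
  from sums_add[OF sums_mult[OF dirichlet_series_sums[OF abs_conv_right_of_1_const s], of "s - 1"] this]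
  have "(\<lambda>n. zeta_reg_term n s) sums ((s - 1) * zeta_series s)"
    by (simp add: zeta_reg_term_def algebra_simps del: of_nat_Suc)
  then show ?thesis by (simp add: zeta_reg_def sums_iff)
qed

lemma deriv_zeta_reg:
  assumes s: "Re s > 1"
  shows "deriv zeta_reg s = zeta_reg s * (1 / (s - 1) - mangoldt_series s)"
proof (rule DERIV_imp_deriv)
  have s1: "s - 1 \<noteq> 0" using s by auto
  have "((\<lambda>s. (s - 1) * zeta_series s) has_field_derivative
      zeta_reg s * (1 / (s - 1) - mangoldt_series s)) (at s)"
    by (rule derivative_eq_intros zeta_deriv[OF s] refl)+
       (use s1 in \<open>simp add: zeta_reg_eq[OF s] field_simps\<close>)
  then show "(zeta_reg has_field_derivative zeta_reg s * (1 / (s - 1) - mangoldt_series s)) (at s)"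
    by (rule has_field_derivative_transform_within_open[where S = "{s. Re s > 1}"])
       (use s in \<open>auto simp: zeta_reg_eq open_halfspace_Re_gt\<close>)
qed

text \<open>k is the order of vanishing at z: if f = (s - z)^k g with g nonzero near z, then f'/f =
  k/(s - z) + g'/g. The point w rules out f = 0, where the order would be infinite.\<close>

lemma tendsto_log_deriv_order:
  assumes f: "f holomorphic_on S" and S: "open S" "connected S" and z: "z \<in> S" and w: "w \<in> S" "f w \<noteq> 0"
  obtains k :: nat where "((\<lambda>s. (s - z) * (deriv f s / f s)) \<longlongrightarrow> of_nat k) (at z)"
    "f z = 0 \<longleftrightarrow> k > 0" "\<forall>\<^sub>F s in at z. f s \<noteq> 0"
proof (cases "f z = 0")
  case False
  have "isCont f z"
    using holomorphic_on_imp_continuous_on[OF f] S z by (simp add: continuous_on_eq_continuous_at)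
  moreover have "isCont (deriv f) z"
    using holomorphic_on_imp_continuous_on[OF holomorphic_deriv[OF f S(1)]] S z by (simp add: continuous_on_eq_continuous_at)
  ultimately have "((\<lambda>s. (s - z) * (deriv f s / f s)) \<longlongrightarrow> (z - z) * (deriv f z / f z)) (at z)"
    using False by (intro tendsto_intros) (auto simp: isCont_def)
  moreover have "\<forall>\<^sub>F s in at z. f s \<noteq> 0"
    using \<open>isCont f z\<close> False by (intro tendsto_imp_eventually_ne) (auto simp: isCont_def)
  ultimately show ?thesis using False by (intro that[of 0]) auto
next
  case True
  then have "\<not> f constant_on S" unfolding constant_on_def using w z by metis
  from holomorphic_factor_zero_nonconstant[OF f S z True this] obtain g r n
    where n: "0 < n" "0 < r" "ball z r \<subseteq> S" and g: "g holomorphic_on ball z r"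
      and fg: "\<And>w. w \<in> ball z r \<Longrightarrow> f w = (w - z)^n * g w" and g0: "\<And>w. w \<in> ball z r \<Longrightarrow> g w \<noteq> 0" by metis
  have "isCont g z"
    using holomorphic_on_imp_continuous_on[OF g] n by (simp add: continuous_on_eq_continuous_at)
  moreover have "isCont (deriv g) z"
    using holomorphic_on_imp_continuous_on[OF holomorphic_deriv[OF g]] n by (simp add: continuous_on_eq_continuous_at)
  ultimately have "((\<lambda>s. of_nat n + (s - z) * (deriv g s / g s)) \<longlongrightarrow> of_nat n + (z - z) * (deriv g z / g z)) (at z)"
    using g0[of z] n by (intro tendsto_intros) (auto simp: isCont_def)
  note lim = this
  have ev: "\<forall>\<^sub>F s in at z. s \<in> ball z r - {z}"
    using n by (intro eventually_at_in_open) auto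
  have *: "f s \<noteq> 0 \<and> of_nat n + (s - z) * (deriv g s / g s) = (s - z) * (deriv f s / f s)" if s: "s \<in> ball z r - {z}" for s
  proof -
    have gd: "(g has_field_derivative deriv g s) (at s)"
      using g s by (intro holomorphic_derivI[of g "ball z r"]) auto
    have "((\<lambda>w. (w - z)^n * g w) has_field_derivative
        of_nat n * (s - z)^(n - 1) * g s + (s - z)^n * deriv g s) (at s)"
      by (rule derivative_eq_intros gd refl)+ simp
    then have "(f has_field_derivative
        of_nat n * (s - z)^(n - 1) * g s + (s - z)^n * deriv g s) (at s)"
      by (rule has_field_derivative_transform_within_open[where S = "ball z r"]) (use s fg in auto)
    then have df: "deriv f s = of_nat n * (s - z)^(n - 1) * g s + (s - z)^n * deriv g s"
      by (rule DERIV_imp_deriv)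
    have p: "(s - z)^n = (s - z) * (s - z)^(n - 1)" using n by (cases n) auto
    have "of_nat n + a * (dg / b) = a * ((of_nat n * q * b + (a * q) * dg) / ((a * q) * b))"
      if "a \<noteq> 0" "b \<noteq> 0" "q \<noteq> 0" for a b q dg :: complex
      using that by (simp add: field_simps)
    from this[of "s - z" "g s" "(s - z)^(n - 1)" "deriv g s"] show ?thesis
      using s g0[of s] fg[of s] unfolding df p by auto
  qed
  have "((\<lambda>s. (s - z) * (deriv f s / f s)) \<longlongrightarrow> of_nat n) (at z)"
    using Lim_transform_eventually[OF lim eventually_mono[OF ev conjunct2[OF *]]] by simp
  moreover have "\<forall>\<^sub>F s in at z. f s \<noteq> 0" using ev by eventually_elim (use * in auto)
  ultimately show ?thesis using True n by (intro that[of n]) auto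
qed

text \<open>Moving to z horizontally from the right stays in Re s > 1, where the logarithmic
  derivative is a series. So the order of a zero on the boundary line can be read off from sums with
  the nonnegative weights Lambda(n).\<close>

lemma zeta_reg_order:
  assumes z: "Re z \<ge> 1"
  obtains k :: nat where "((\<lambda>h. of_real h * (1 / (z + of_real h - 1) - mangoldt_series (z + of_real h))) \<longlongrightarrow> of_nat k) (at_right 0)"
    "zeta_reg z = 0 \<longleftrightarrow> k > 0"
proof -
  have "connected {s. Re s > 0}" by (intro convex_connected convex_halfspace_Re_gt)
  with tendsto_log_deriv_order[OF zeta_reg_holomorphic _ _ , of z 1] z
  obtain k :: nat where k: "((\<lambda>s. (s - z) * (deriv zeta_reg s / zeta_reg s)) \<longlongrightarrow> of_nat k) (at z)"
    "zeta_reg z = 0 \<longleftrightarrow> k > 0" "\<forall>\<^sub>F s in at z. zeta_reg s \<noteq> 0"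
    by (auto simp: zeta_reg_1 open_halfspace_Re_gt)
  have lim: "filterlim (\<lambda>h::real. z + of_real h) (at z) (at_right 0)"
    unfolding filterlim_at by (auto intro!: tendsto_eq_intros simp: eventually_at_filter)
  have "\<forall>\<^sub>F h in at_right (0::real). zeta_reg (z + of_real h) \<noteq> 0"
    using lim k(3) by (auto simp: filterlim_iff)
  moreover have "\<forall>\<^sub>F h in at_right (0::real). h > 0" by (simp add: eventually_at_filter)
  ultimately have "\<forall>\<^sub>F h in at_right (0::real). (z + of_real h - z) * (deriv zeta_reg (z + of_real h) / zeta_reg (z + of_real h))
      = of_real h * (1 / (z + of_real h - 1) - mangoldt_series (z + of_real h))"
    by eventually_elim (use z in \<open>auto simp: deriv_zeta_reg\<close>)
  from Lim_transform_eventually[OF filterlim_compose[OF k(1) lim] this] k(2) show ?thesis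
    by (intro that) auto
qed

text \<open>The Mangoldt series is continuous at z, so its product with h tends to 0 and the order
  is 0.\<close>

lemma zeta_reg_nonzero_right:
  assumes z: "Re z > 1"
  shows "zeta_reg z \<noteq> 0"
proof -
  obtain k :: nat where k: "((\<lambda>h. of_real h * (1 / (z + of_real h - 1) - mangoldt_series (z + of_real h))) \<longlongrightarrow> of_nat k) (at_right 0)"
    "zeta_reg z = 0 \<longleftrightarrow> k > 0" using zeta_reg_order[of z] z by auto
  have "isCont mangoldt_series z"
    using DERIV_isCont[OF dirichlet_series_deriv[OF abs_conv_right_of_1_mangoldt z]] .
  moreover have "((\<lambda>h::real. z + of_real h) \<longlongrightarrow> z) (at_right 0)"
    by (auto intro!: tendsto_eq_intros)
  ultimately have "((\<lambda>h::real. mangoldt_series (z + of_real h)) \<longlongrightarrow> mangoldt_series z) (at_right 0)"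
    by (rule isCont_tendsto_compose)
  then have "((\<lambda>h. of_real h * (1 / (z + of_real h - 1) - mangoldt_series (z + of_real h))) \<longlongrightarrow> of_real 0 * (1 / (z + of_real 0 - 1) - mangoldt_series z)) (at_right 0)"
    using z by (intro tendsto_intros) auto
  from tendsto_unique[OF trivial_limit_at_right_real k(1) this] have "of_nat k = (0 :: complex)"
    by simp
  with k(2) show ?thesis by simp
qed

lemma Re_of_nat_powr:
  assumes "n > 0"
  shows "Re (of_nat n powr (-(of_real \<sigma> + \<i> * of_real t))) = real n powr (-\<sigma>) * cos (t * ln (real n))"
  using assms by (simp add: powr_def Re_exp Ln_of_nat mult_ac)

text \<open>Each term carries the factor 3 + 4 cos x + cos 2x = 2 (1 + cos x)^2 with x = t ln n, and
  Lambda(n) \<ge> 0.\<close>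

lemma mangoldt_series_341:
  assumes \<sigma>: "\<sigma> > 1"
  shows "3 * Re (mangoldt_series (of_real \<sigma>)) + 4 * Re (mangoldt_series (of_real \<sigma> + \<i> * of_real t))
     + Re (mangoldt_series (of_real \<sigma> + \<i> * of_real (2 * t))) \<ge> 0"
proof -
  define u where "u t n = Re (mangoldt n * of_nat n powr (-(of_real \<sigma> + \<i> * of_real t)))" for t n
  have u: "u t sums Re (mangoldt_series (of_real \<sigma> + \<i> * of_real t))" for t
    unfolding u_def using \<sigma> by (intro sums_Re dirichlet_series_sums abs_conv_right_of_1_mangoldt) auto
  have s: "(\<lambda>n. 3 * u 0 n + 4 * u t n + u (2 * t) n) sums
     (3 * Re (mangoldt_series (of_real \<sigma> + \<i> * of_real 0)) + 4 * Re (mangoldt_series (of_real \<sigma> + \<i> * of_real t))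
     + Re (mangoldt_series (of_real \<sigma> + \<i> * of_real (2 * t))))"
    by (intro sums_add sums_mult u)
  have pos: "3 * u 0 n + 4 * u t n + u (2 * t) n \<ge> 0" for n
  proof (cases "n = 0")
    case False
    let ?x = "t * ln (real n)"
    have "u t n = mangoldt n * (real n powr (-\<sigma>) * cos (t * ln (real n)))" for t
    proof -
      have "u t n = mangoldt n * Re (of_nat n powr (-(of_real \<sigma> + \<i> * of_real t)))"
      proof -
        have "Re (of_real (mangoldt n) * w) = mangoldt n * Re w" for w by (simp del: of_real_mangoldt)
        from this[unfolded of_real_mangoldt] show ?thesis by (simp only: u_def)
      qed
      then show ?thesis using False by (simp only: Re_of_nat_powr)
    qed
    then have "3 * u 0 n + 4 * u t n + u (2 * t) n
        = mangoldt n * real n powr (-\<sigma>) * (3 + 4 * cos ?x + cos (2 * ?x))"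
      by (simp add: algebra_simps)
    also have "3 + 4 * cos ?x + cos (2 * ?x) = 2 * (1 + cos ?x)\<^sup>2"
      unfolding cos_double_cos by (simp add: power2_eq_square algebra_simps)
    finally show ?thesis by (simp add: mangoldt_nonneg)
  qed (auto simp: u_def)
  show ?thesis using sums_le[OF pos sums_zero s] by simp
qed

text \<open>Mertens' argument: with orders k at 1 + it and l at 1 + 2it, the 3-4-1 inequality times
  h becomes 3 - 4k - l \<ge> 0 as h tends to 0, which forces k = 0. The 3 stems from the simple pole
  at 1.\<close>

lemma zeta_reg_nonzero:
  assumes z: "Re z \<ge> 1"
  shows "zeta_reg z \<noteq> 0"
proof (cases "Re z > 1 \<or> z = 1")
  case True
  then show ?thesis using zeta_reg_nonzero_right zeta_reg_1 by auto
next
  case False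
  define t where "t = Im z"
  have zt: "z = 1 + \<i> * of_real t" and t: "t \<noteq> 0"
    using z False by (auto simp: complex_eq_iff t_def)
  \<comment> \<open>For t nonzero, 1/(s - 1) is bounded near 1 + it and disappears in the
    limit.\<close>
  have ord: "\<exists>k::nat. ((\<lambda>h. h * Re (mangoldt_series (of_real (1 + h) + \<i> * of_real t))) \<longlongrightarrow> - real k) (at_right 0) \<and>
      (zeta_reg (1 + \<i> * of_real t) = 0 \<longleftrightarrow> k > 0)" if t: "t \<noteq> 0" for t
  proof -
    let ?z = "1 + \<i> * of_real t"
    obtain k :: nat where k: "((\<lambda>h. of_real h * (1 / (?z + of_real h - 1) - mangoldt_series (?z + of_real h))) \<longlongrightarrow> of_nat k) (at_right 0)"
      "zeta_reg ?z = 0 \<longleftrightarrow> k > 0" using zeta_reg_order[of ?z] by auto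
    have "((\<lambda>h. of_real h * (1 / (?z + of_real h - 1))) \<longlongrightarrow> of_real 0 * (1 / (?z + of_real 0 - 1))) (at_right 0)"
      using t by (intro tendsto_intros) auto
    from tendsto_Re[OF tendsto_diff[OF this k(1)]]
    have "((\<lambda>h. h * Re (mangoldt_series (of_real (1 + h) + \<i> * of_real t))) \<longlongrightarrow> - real k) (at_right 0)"
      by (simp add: algebra_simps)
    with k show ?thesis by blast
  qed
  \<comment> \<open>Here h times the pole term is identically 1 and the order of
    \<open>zeta_reg\<close> is 0.\<close>
  have one: "((\<lambda>h. h * Re (mangoldt_series (of_real (1 + h)))) \<longlongrightarrow> 1) (at_right 0)"
  proof -
    obtain k :: nat where k: "((\<lambda>h. of_real h * (1 / (1 + of_real h - 1) - mangoldt_series (1 + of_real h))) \<longlongrightarrow> of_nat k) (at_right 0)"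
      "zeta_reg 1 = 0 \<longleftrightarrow> k > 0" using zeta_reg_order[of 1] by auto
    then have "k = 0" by (simp add: zeta_reg_1)
    with tendsto_diff[OF tendsto_const[of 1] tendsto_Re[OF k(1)]]
    have "((\<lambda>h. 1 - Re (of_real h * (1 / (1 + of_real h - 1) - mangoldt_series (1 + of_real h)))) \<longlongrightarrow> 1) (at_right 0)"
      by simp
    moreover have "\<forall>\<^sub>F h in at_right 0. 1 - Re (of_real h * (1 / (1 + of_real h - 1) - mangoldt_series (1 + of_real h)))
        = h * Re (mangoldt_series (of_real (1 + h)))"
      by (rule eventually_mono[of "\<lambda>h. h \<noteq> 0"]) (auto simp: algebra_simps eventually_at_filter)
    ultimately show ?thesis by (rule Lim_transform_eventually)
  qed
  obtain k l :: nat where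
    k: "((\<lambda>h. h * Re (mangoldt_series (of_real (1 + h) + \<i> * of_real t))) \<longlongrightarrow> - real k) (at_right 0)"
      "zeta_reg z = 0 \<longleftrightarrow> k > 0" and
    l: "((\<lambda>h. h * Re (mangoldt_series (of_real (1 + h) + \<i> * of_real (2 * t)))) \<longlongrightarrow> - real l) (at_right 0)"
    using ord[of t] ord[of "2 * t"] t zt by auto
  have "((\<lambda>h. 3 * (h * Re (mangoldt_series (of_real (1 + h)))) + 4 * (h * Re (mangoldt_series (of_real (1 + h) + \<i> * of_real t)))
     + h * Re (mangoldt_series (of_real (1 + h) + \<i> * of_real (2 * t)))) \<longlongrightarrow> 3 * 1 + 4 * (- real k) + - real l) (at_right 0)"
    by (intro tendsto_intros one k l)
  moreover have "\<forall>\<^sub>F h in at_right 0. 3 * (h * Re (mangoldt_series (of_real (1 + h)))) + 4 * (h * Re (mangoldt_series (of_real (1 + h) + \<i> * of_real t)))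
     + h * Re (mangoldt_series (of_real (1 + h) + \<i> * of_real (2 * t))) \<ge> 0"
    unfolding eventually_at_filter
  proof (intro always_eventually allI impI)
    fix h :: real assume "h \<noteq> 0" "h \<in> {0<..}"
    then have "h * (3 * Re (mangoldt_series (of_real (1 + h))) + 4 * Re (mangoldt_series (of_real (1 + h) + \<i> * of_real t))
     + Re (mangoldt_series (of_real (1 + h) + \<i> * of_real (2 * t)))) \<ge> 0"
      by (intro mult_nonneg_nonneg mangoldt_series_341) auto
    then show "3 * (h * Re (mangoldt_series (of_real (1 + h)))) + 4 * (h * Re (mangoldt_series (of_real (1 + h) + \<i> * of_real t)))
     + h * Re (mangoldt_series (of_real (1 + h) + \<i> * of_real (2 * t))) \<ge> 0"
      by (simp only: distrib_left mult_ac)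
  qed
  ultimately have "0 \<le> 3 * 1 + 4 * (- real k) + - real l"
    by (intro tendsto_lowerbound[of _ _ "at_right (0::real)"]) auto
  then have "k = 0" by linarith
  with k show ?thesis by simp
qed

text \<open>Both series have a simple pole with residue 1 at s = 1, and the poles cancel. The zeros
  of zeta are left out of U, which still covers Re s \<ge> 1.\<close>

lemma mangoldt_minus_one_series_extends:
  obtains U G where "open U" "{s. Re s \<ge> 1} \<subseteq> U" "G holomorphic_on U"
    "\<And>s. Re s > 1 \<Longrightarrow> G s = mangoldt_series s - zeta_series s"
proof -
  let ?S = "{s. Re s > 0}"
  define U where "U = {s \<in> ?S. zeta_reg s \<noteq> 0}"
  \<comment> \<open>\<open>f\<close> is zeta(s) - 1/(s - 1) with the removable singularity filled
    in, as \<open>zeta_reg 1 = 1\<close>.\<close>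
  define f where "f s = (if s = 1 then deriv zeta_reg 1 else zeta_reg s / (s - 1) - zeta_reg 1 / (s - 1))" for s
  have oS: "open ?S" by (simp add: open_halfspace_Re_gt)
  have "open (?S \<inter> zeta_reg -` (- {0}))"
    by (rule continuous_open_preimage[OF holomorphic_on_imp_continuous_on[OF zeta_reg_holomorphic] oS]) auto
  also have "?S \<inter> zeta_reg -` (- {0}) = U" by (auto simp: U_def)
  finally have U: "open U" .
  have US: "U \<subseteq> ?S" by (auto simp: U_def)
  have "f holomorphic_on ?S"
    unfolding f_def[abs_def] by (rule pole_theorem_open[OF zeta_reg_holomorphic oS]) auto
  then have "f holomorphic_on U" "deriv zeta_reg holomorphic_on U" "zeta_reg holomorphic_on U"
    using holomorphic_deriv[OF zeta_reg_holomorphic oS] zeta_reg_holomorphic US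
    by (auto intro: holomorphic_on_subset)
  then have "(\<lambda>s. - deriv zeta_reg s / zeta_reg s - f s) holomorphic_on U"
    using U by (intro holomorphic_intros) (auto simp: U_def)
  moreover have "{s. Re s \<ge> 1} \<subseteq> U" by (auto simp: U_def zeta_reg_nonzero)
  moreover have "- deriv zeta_reg s / zeta_reg s - f s = mangoldt_series s - zeta_series s" if s: "Re s > 1" for s
  proof -
    have "zeta_reg s \<noteq> 0" "s \<noteq> 1" using zeta_reg_nonzero[of s] s by auto
    then have "- deriv zeta_reg s / zeta_reg s = mangoldt_series s - 1 / (s - 1)"
      by (simp add: deriv_zeta_reg[OF s])
    moreover have "f s = zeta_series s - 1 / (s - 1)"
      using \<open>s \<noteq> 1\<close> by (simp add: f_def zeta_reg_1 zeta_reg_eq[OF s])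
    ultimately show ?thesis by simp
  qed
  ultimately show ?thesis using U that by blast
qed

section \<open>The Fejer kernel\<close>

text \<open>This is (sin (u/2) / (u/2))^2, the Fourier transform of the triangle function on
  [-1, 1].\<close>

definition fejer :: "real \<Rightarrow> real" where
  "fejer u = (if u = 0 then 1 else 2 * (1 - cos u) / u\<^sup>2)"

lemma fejer_mult_square: "fejer u * u\<^sup>2 = 2 * (1 - cos u)"
  by (simp add: fejer_def)

lemma fejer_nonneg: "fejer u \<ge> 0"
  by (simp add: fejer_def)

lemma fejer_le_1: "fejer u \<le> 1"
proof (cases "u = 0")
  case False
  have "cos u = 1 - 2 * (sin (u / 2))\<^sup>2" using cos_double_sin[of "u / 2"] by simp
  moreover have "(sin (u / 2))\<^sup>2 \<le> (u / 2)\<^sup>2"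
    by (rule abs_le_square_iff[THEN iffD1, OF abs_sin_x_le_abs_x])
  ultimately have "2 * (1 - cos u) \<le> u\<^sup>2" by (simp add: power_divide)
  then show ?thesis using False by (simp add: fejer_def)
qed (simp add: fejer_def)

text \<open>The bounded range of frequencies t is what confines the Dirichlet series to a bounded
  vertical segment.\<close>

lemma fejer_has_integral: "((\<lambda>t. 2 * (1 - t) * cos (t * u)) has_integral fejer u) {0..1}"
proof (cases "u = 0")
  case True
  have "((\<lambda>t. 2 * (1 - t)) has_integral (2 * 1 - 1\<^sup>2) - (2 * 0 - 0\<^sup>2)) {0..1::real}"
    by (rule fundamental_theorem_of_calculus)
       (auto intro!: derivative_eq_intros simp: has_real_derivative_iff_has_vector_derivative[symmetric])
  then show ?thesis using True by (simp add: fejer_def)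
next
  case False
  define F where "F t = 2 * ((1 - t) * sin (t * u) / u - cos (t * u) / u\<^sup>2)" for t
  have "((\<lambda>t. 2 * (1 - t) * cos (t * u)) has_integral F 1 - F 0) {0..1}"
    unfolding F_def
    by (rule fundamental_theorem_of_calculus)
       (use False in \<open>auto intro!: derivative_eq_intros
          simp: has_real_derivative_iff_has_vector_derivative[symmetric] field_simps power2_eq_square\<close>)
  also have "F 1 - F 0 = fejer u" using False by (simp add: F_def fejer_def field_simps)
  finally show ?thesis .
qed

lemma fejer_ge_half:
  assumes "\<bar>u\<bar> \<le> 1"
  shows "fejer u \<ge> 1 / 2"
proof -
  have "((\<lambda>t. 2 * (1 - t) * (1 / 2)) has_integral fejer 0 * (1 / 2)) {0..1}"
    using has_integral_mult_left[OF fejer_has_integral[of 0], of "1 / 2"] by simp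
  then have "fejer 0 * (1 / 2) \<le> fejer u"
  proof (rule has_integral_le[OF _ fejer_has_integral])
    fix t :: real assume t: "t \<in> {0..1}"
    have "\<bar>t * u\<bar> \<le> 1 * 1" unfolding abs_mult using t assms by (intro mult_mono) auto
    then have "\<bar>t * u\<bar> \<le> pi / 3" using pi_gt3 by linarith
    then have "cos (pi / 3) \<le> cos \<bar>t * u\<bar>" using pi_gt_zero by (intro cos_monotone_0_pi_le) linarith+
    then show "2 * (1 - t) * (1 / 2) \<le> 2 * (1 - t) * cos (t * u)"
      using t by (intro mult_left_mono) (auto simp: cos_60)
  qed
  then show ?thesis by (simp add: fejer_def)
qed

lemma fejer_le: "fejer u \<le> 5 / (1 + u\<^sup>2)"
proof -
  have "fejer u * u\<^sup>2 \<le> 4"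
    unfolding fejer_mult_square using cos_ge_minus_one[of u] by argo
  then have "fejer u * (1 + u\<^sup>2) \<le> 5"
    using fejer_le_1[of u] by (simp add: distrib_left)
  then show ?thesis by (simp add: pos_le_divide_eq add_pos_nonneg)
qed


(* The zeros of the two shifted kernels are disjoint because (1 - cos u) + (1 + cos u) = 2. *)
lemma fejer_add_shift_ge: "1 / (1 + u\<^sup>2) \<le> 8 * (fejer u + fejer (u + pi))"
proof -
  let ?M = "32 * (1 + u\<^sup>2)"
  have "pi\<^sup>2 \<le> 4\<^sup>2" using pi_less_4 pi_gt_zero by (intro power_mono) auto
  moreover have "(u + pi)\<^sup>2 \<le> 2 * u\<^sup>2 + 2 * pi\<^sup>2"
    using zero_le_power2[of "u - pi"] unfolding power2_sum power2_diff by linarith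
  moreover have "q \<le> 32 * (1 + a)" if "q \<le> 2 * a + 2 * p" "p \<le> 4\<^sup>2" "0 \<le> a" for q a p :: real
    using that by simp
  ultimately have "(u + pi)\<^sup>2 \<le> ?M" using zero_le_power2 by blast
  have "u\<^sup>2 \<le> ?M" by simp
  with \<open>(u + pi)\<^sup>2 \<le> ?M\<close> have "fejer (u + pi) * (u + pi)\<^sup>2 \<le> fejer (u + pi) * ?M" "fejer u * u\<^sup>2 \<le> fejer u * ?M"
    by (auto intro!: mult_left_mono fejer_nonneg)
  then have "4 \<le> (fejer u + fejer (u + pi)) * ?M"
    unfolding fejer_mult_square distrib_right by (simp add: cos_add)
  then have "1 \<le> 8 * (fejer u + fejer (u + pi)) * (1 + u\<^sup>2)" by argo
  then show ?thesis by (subst pos_divide_le_eq) (auto simp: add_pos_nonneg)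
qed

lemma continuous_on_of_nat_powr:
  assumes "continuous_on A f"
  shows "continuous_on A (\<lambda>t. of_nat n powr f t :: complex)"
  using assms by (cases "n = 0") (auto simp: powr_def intro!: continuous_intros)

text \<open>The cosine in the kernel is the real part of exp (-i T y t) n^(i T t), which moves the
  argument of the Dirichlet series to \<sigma> - i T t. Sum and integral commute by uniform
  convergence in t at fixed \<sigma> > 1.\<close>

lemma fejer_sum_eq_integral:
  fixes c :: "nat \<Rightarrow> real"
  assumes c: "abs_conv_right_of_1 (\<lambda>n. of_real (c n))" and \<sigma>: "\<sigma> > 1"
  shows "(\<lambda>n. c n * real n powr (-\<sigma>) * fejer (T * (ln (real n) - y))) sums
    Re (integral {0..1} (\<lambda>t. exp (\<i> * of_real (- T * y * t)) *
          (of_real (2 * (1 - t)) * dirichlet_series (\<lambda>n. of_real (c n)) (of_real \<sigma> + of_real t * (- \<i> * of_real T)))))"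
proof -
  define s where "s t = of_real \<sigma> + of_real t * (- \<i> * of_real T)" for t
  define w where "w t = exp (\<i> * of_real (- T * y * t)) * of_real (2 * (1 - t))" for t
  define v where "v n t = w t * (of_real (c n) * of_nat n powr (- s t))" for n t
  have Res [simp]: "Re (s t) = \<sigma>" for t by (simp add: s_def)
  have nw: "norm (w t) \<le> 2" if "t \<in> {0..1}" for t
    using that by (simp add: w_def norm_mult del: of_real_mult of_real_diff)
  have ul: "uniform_limit {0..1} (\<lambda>N t. \<Sum>n<N. v n t) (\<lambda>t. \<Sum>n. v n t) sequentially"
  proof (rule Weierstrass_m_test)
    fix n t assume "t \<in> {0..1::real}"
    then have "norm (w t) * (norm (c n) * real n powr (-\<sigma>)) \<le> 2 * (norm (c n) * real n powr (-\<sigma>))"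
      using nw by (intro mult_right_mono) auto
    then show "norm (v n t) \<le> 2 * (norm (c n) * real n powr (-\<sigma>))"
      by (simp add: v_def norm_mult norm_of_nat_powr)
  next
    show "summable (\<lambda>n. 2 * (norm (c n) * real n powr (-\<sigma>)))"
      using c \<sigma> by (intro summable_mult) (simp add: abs_conv_right_of_1_def)
  qed
  have cont: "continuous_on {0..1} (\<lambda>t. \<Sum>n<N. v n t)" for N
    unfolding v_def w_def s_def by (intro continuous_intros continuous_on_of_nat_powr)
  obtain I J where I: "\<And>N. ((\<lambda>t. \<Sum>n<N. v n t) has_integral I N) {0..1}"
    and J: "((\<lambda>t. \<Sum>n. v n t) has_integral J) {0..1}" and IJ: "I \<longlonglongrightarrow> J"
    by (rule uniform_limit_integral[OF ul cont]) auto
  have "Re (v n t) = c n * real n powr (-\<sigma>) * (2 * (1 - t) * cos (t * (T * (ln (real n) - y))))" for n t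
  proof (cases "n = 0")
    case False
    have "exp (\<i> * of_real (- T * y * t)) * of_nat n powr (- s t)
        = exp (of_real (- \<sigma> * ln (real n)) + \<i> * of_real (t * (T * (ln (real n) - y))))"
      using False by (simp add: powr_def s_def Ln_of_nat exp_add[symmetric] algebra_simps)
    then have "v n t = of_real (2 * (1 - t) * c n) *
       exp (of_real (- \<sigma> * ln (real n)) + \<i> * of_real (t * (T * (ln (real n) - y))))"
      by (simp add: v_def w_def mult_ac)
    also have "Re \<dots> = (2 * (1 - t) * c n) * Re (exp (of_real (- \<sigma> * ln (real n)) + \<i> * of_real (t * (T * (ln (real n) - y)))))"
      by (simp del: of_real_mult)
    finally show ?thesis using False by (simp add: Re_exp powr_def mult_ac)
  qed (simp add: v_def)
  moreover have "((\<lambda>t. \<Sum>n<N. c n * real n powr (-\<sigma>) * (2 * (1 - t) * cos (t * (T * (ln (real n) - y))))) has_integral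
      (\<Sum>n<N. c n * real n powr (-\<sigma>) * fejer (T * (ln (real n) - y)))) {0..1}" for N
    by (intro has_integral_sum has_integral_mult_right fejer_has_integral) auto
  ultimately have "((\<lambda>t. Re (\<Sum>n<N. v n t)) has_integral
      (\<Sum>n<N. c n * real n powr (-\<sigma>) * fejer (T * (ln (real n) - y)))) {0..1}" for N
    by simp
  from has_integral_unique[OF has_integral_Re[OF I] this]
  have "Re (I N) = (\<Sum>n<N. c n * real n powr (-\<sigma>) * fejer (T * (ln (real n) - y)))" for N .
  with tendsto_Re[OF IJ] have "(\<lambda>n. c n * real n powr (-\<sigma>) * fejer (T * (ln (real n) - y))) sums Re J"
    by (simp add: sums_def)
  also have "J = integral {0..1} (\<lambda>t. \<Sum>n. v n t)" using J by (simp add: integral_unique)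
  also have "(\<lambda>t. \<Sum>n. v n t) = (\<lambda>t. exp (\<i> * of_real (- T * y * t)) *
          (of_real (2 * (1 - t)) * dirichlet_series (\<lambda>n. of_real (c n)) (s t)))"
  proof
    fix t
    have "(\<Sum>n. v n t) = w t * dirichlet_series (\<lambda>n. of_real (c n)) (s t)"
      using sums_mult[OF dirichlet_series_sums[OF c, of "s t"], of "w t"] \<sigma> by (simp add: v_def sums_iff)
    then show "(\<Sum>n. v n t) = exp (\<i> * of_real (- T * y * t)) *
          (of_real (2 * (1 - t)) * dirichlet_series (\<lambda>n. of_real (c n)) (s t))"
      by (simp add: w_def mult.assoc)
  qed
  finally show ?thesis unfolding s_def .
qed

text \<open>One integration by parts gains 1/w; the two boundary values cost 2 A and the derivative
  costs B.\<close>

lemma norm_oscillatory_integral_le: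
  fixes F F' :: "real \<Rightarrow> complex"
  assumes F: "\<And>t. t \<in> {0..1} \<Longrightarrow> (F has_vector_derivative F' t) (at t within {0..1})"
    and F': "continuous_on {0..1} F'"
    and A: "\<And>t. t \<in> {0..1} \<Longrightarrow> norm (F t) \<le> A" and B: "\<And>t. t \<in> {0..1} \<Longrightarrow> norm (F' t) \<le> B"
    and w: "w \<noteq> 0"
  shows "norm (integral {0..1} (\<lambda>t. exp (\<i> * of_real (w * t)) * F t)) \<le> (2 * A + B) / \<bar>w\<bar>"
proof -
  define e where "e t = exp (\<i> * of_real (w * t))" for t :: real
  define H where "H t = e t * F t / (\<i> * of_real w)" for t
  have ne: "norm (e t) = 1" for t by (simp add: e_def)
  have e': "(e has_vector_derivative \<i> * of_real w * e t) (at t within {0..1})" for t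
  proof -
    have "((\<lambda>z. exp (\<i> * of_real w * z)) has_field_derivative \<i> * of_real w * e t) (at (of_real t))"
      by (auto intro!: derivative_eq_intros simp: e_def mult_ac)
    from has_vector_derivative_real_field[OF this] show ?thesis by (simp add: e_def[abs_def] mult_ac)
  qed
  have H: "((\<lambda>t. e t * F t + e t * F' t / (\<i> * of_real w)) has_integral H 1 - H 0) {0..1}"
  proof (rule fundamental_theorem_of_calculus)
    fix t :: real assume t: "t \<in> {0..1}"
    have "((\<lambda>t. e t * F t) has_vector_derivative e t * F' t + \<i> * of_real w * e t * F t) (at t within {0..1})"
      by (rule has_vector_derivative_mult[OF e' F[OF t]])
    then show "(H has_vector_derivative e t * F t + e t * F' t / (\<i> * of_real w)) (at t within {0..1})"
      unfolding H_def by (rule has_vector_derivative_eq_rhs[OF has_vector_derivative_divide])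
                        (use w in \<open>simp add: field_simps\<close>)
  qed simp
  have cF': "continuous_on {0..1} (\<lambda>t. e t * F' t / (\<i> * of_real w))"
    unfolding e_def using w by (intro continuous_intros F') auto
  then have i: "((\<lambda>t. e t * F' t / (\<i> * of_real w)) has_integral integral {0..1} (\<lambda>t. e t * F' t / (\<i> * of_real w))) {0..1}"
    by (intro integrable_integral integrable_continuous_interval)
  have "norm (integral {0..1} (\<lambda>t. e t * F' t / (\<i> * of_real w))) \<le> (B / \<bar>w\<bar>) * (1 - 0)"
    by (rule integral_bound[OF _ cF']) (use B ne in \<open>auto simp: norm_mult norm_divide intro!: divide_right_mono\<close>)
  moreover have "norm (H t) \<le> A / \<bar>w\<bar>" if "t \<in> {0..1}" for t
    using A[OF that] ne by (auto simp: H_def norm_mult norm_divide intro!: divide_right_mono)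
  from this[of 0] this[of 1] have "norm (H 1 - H 0) \<le> 2 * A / \<bar>w\<bar>"
    using norm_triangle_ineq4[of "H 1" "H 0"] by simp
  moreover have "integral {0..1} (\<lambda>t. e t * F t) = H 1 - H 0 - integral {0..1} (\<lambda>t. e t * F' t / (\<i> * of_real w))"
    using has_integral_diff[OF H i] by (simp add: integral_unique)
  ultimately show ?thesis
    using norm_triangle_ineq4[of "H 1 - H 0" "integral {0..1} (\<lambda>t. e t * F' t / (\<i> * of_real w))"]
    by (simp add: e_def add_divide_distrib)
qed

text \<open>For \<sigma> in (1, 2] the arguments \<sigma> - i T t stay in one compact box inside U,
  so G and its derivative are bounded independently of \<sigma>. This uniformity is what later
  allows \<sigma> to depend on y.\<close>

lemma fejer_sum_bound:
  fixes c :: "nat \<Rightarrow> real"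
  assumes c: "abs_conv_right_of_1 (\<lambda>n. of_real (c n))"
    and U: "open U" "{s. Re s \<ge> 1} \<subseteq> U" and G: "G holomorphic_on U"
    and GD: "\<And>s. Re s > 1 \<Longrightarrow> G s = dirichlet_series (\<lambda>n. of_real (c n)) s"
    and T: "T > 0"
  obtains C where "C \<ge> 0" "\<And>\<sigma> y. 1 < \<sigma> \<Longrightarrow> \<sigma> \<le> 2 \<Longrightarrow> y > 0 \<Longrightarrow>
     \<bar>\<Sum>n. c n * real n powr (-\<sigma>) * fejer (T * (ln (real n) - y))\<bar> \<le> C / y"
proof -
  define K where "K = cbox (Complex 1 (-T)) (Complex 2 0)"
  have K: "compact K" "K \<subseteq> U" using U(2) by (auto simp: K_def in_cbox_complex_iff)
  have dG: "deriv G holomorphic_on U" by (rule holomorphic_deriv[OF G U(1)])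
  have bdd: "\<exists>M\<ge>0. \<forall>z\<in>K. norm (f z) \<le> M" if "f holomorphic_on U" for f
  proof -
    have "bounded (f ` K)"
      using that K by (intro compact_imp_bounded compact_continuous_image)
        (auto intro: holomorphic_on_imp_continuous_on holomorphic_on_subset)
    then show ?thesis unfolding bounded_pos by (auto intro: less_imp_le)
  qed
  obtain M where M: "M \<ge> 0" "\<And>z. z \<in> K \<Longrightarrow> norm (G z) \<le> M" using bdd[OF G] by auto
  obtain M' where M': "M' \<ge> 0" "\<And>z. z \<in> K \<Longrightarrow> norm (deriv G z) \<le> M'" using bdd[OF dG] by auto
  \<comment> \<open>2 A + B from the oscillatory bound; w = - T y accounts for the division by
    T.\<close>
  define C where "C = (2 * (2 * M) + (2 * M + 2 * (T * M'))) / T"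
  have "\<bar>\<Sum>n. c n * real n powr (-\<sigma>) * fejer (T * (ln (real n) - y))\<bar> \<le> C / y"
    if \<sigma>: "1 < \<sigma>" "\<sigma> \<le> 2" and y: "y > 0" for \<sigma> y
  proof -
    define s where "s t = of_real \<sigma> + of_real t * (- \<i> * of_real T)" for t :: real
    define F where "F t = of_real (2 * (1 - t)) * G (s t)" for t
    define F' where "F' t = of_real (2 * (1 - t)) * ((- \<i> * of_real T) * deriv G (s t)) + of_real (-2) * G (s t)" for t
    have sK: "s t \<in> K" if "t \<in> {0..1}" for t
      using that \<sigma> T by (auto simp: K_def in_cbox_complex_iff s_def)
    have sU: "s ` {0..1} \<subseteq> U" using sK K by auto
    have cs: "continuous_on {0..1} s" unfolding s_def by (intro continuous_intros)
    have Re_s: "Re (s t) = \<sigma>" for t by (simp add: s_def)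
    have "norm (integral {0..1} (\<lambda>t. exp (\<i> * of_real (- T * y * t)) * F t)) \<le> (2 * (2 * M) + (2 * M + 2 * (T * M'))) / \<bar>- T * y\<bar>"
    proof (rule norm_oscillatory_integral_le[where F' = F'])
      fix t :: real assume t: "t \<in> {0..1}"
      have s': "(s has_vector_derivative - \<i> * of_real T) (at t within {0..1})"
        unfolding s_def by (rule has_vector_derivative_real_field) (auto intro!: derivative_eq_intros)
      have "(G has_field_derivative deriv G (s t)) (at (s t) within s ` {0..1})"
        using sU t by (intro DERIV_subset[OF holomorphic_derivI[OF G U(1)]]) auto
      from field_vector_diff_chain_within[OF s' this]
      have 1: "(G \<circ> s has_vector_derivative - \<i> * of_real T * deriv G (s t)) (at t within {0..1})" .
      have 2: "((\<lambda>t. of_real (2 * (1 - t)) :: complex) has_vector_derivative of_real (-2)) (at t within {0..1})"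
        by (rule has_vector_derivative_of_real) (auto intro!: derivative_eq_intros)
      from has_vector_derivative_mult[OF 2 1]
      show "(F has_vector_derivative F' t) (at t within {0..1})"
        unfolding F_def F'_def o_def .
      have n1: "norm (of_real (2 * (1 - t)) :: complex) \<le> 2" unfolding norm_of_real using t by auto
      then show "norm (F t) \<le> 2 * M"
        unfolding F_def norm_mult using M sK[OF t] by (intro mult_mono) auto
      have "norm (of_real (2 * (1 - t)) * ((- \<i> * of_real T) * deriv G (s t))) \<le> 2 * (T * M')"
        unfolding norm_mult using T M' sK[OF t] n1 by (intro mult_mono) auto
      moreover have "norm (of_real (-2) * G (s t)) \<le> 2 * M"
        unfolding norm_mult using M sK[OF t] by (intro mult_mono) auto
      ultimately show "norm (F' t) \<le> 2 * M + 2 * (T * M')"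
        unfolding F'_def by (intro order_trans[OF norm_triangle_ineq]) linarith
    next
      have "continuous_on {0..1} (\<lambda>t. G (s t))" "continuous_on {0..1} (\<lambda>t. deriv G (s t))"
        by (rule continuous_on_compose2[OF holomorphic_on_imp_continuous_on[OF G] cs sU],
            rule continuous_on_compose2[OF holomorphic_on_imp_continuous_on[OF dG] cs sU])
      then show "continuous_on {0..1} F'" unfolding F'_def by (intro continuous_intros)
    qed (use T y in auto)
    also have "\<dots> = C / y" using T y by (simp add: C_def abs_mult)
    also have "(\<lambda>t. exp (\<i> * of_real (- T * y * t)) * F t) = (\<lambda>t. exp (\<i> * of_real (- T * y * t)) *
          (of_real (2 * (1 - t)) * dirichlet_series (\<lambda>n. of_real (c n)) (of_real \<sigma> + of_real t * (- \<i> * of_real T))))"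
      unfolding F_def using GD Re_s \<sigma> by (simp add: s_def)
    finally show ?thesis
      unfolding sums_unique[OF fejer_sum_eq_integral[OF c \<sigma>(1), of T y], symmetric]
      by (rule order_trans[OF abs_Re_le_cmod])
  qed
  moreover have "C \<ge> 0" using M M' T by (simp add: C_def)
  ultimately show ?thesis using that by blast
qed

section \<open>Prime powers in short intervals\<close>

lemma summable_weighted:
  fixes c g :: "nat \<Rightarrow> real"
  assumes c: "abs_conv_right_of_1 (\<lambda>n. of_real (c n))" and \<sigma>: "\<sigma> > 1" and g: "\<And>n. \<bar>g n\<bar> \<le> B"
  shows "summable (\<lambda>n. c n * real n powr (-\<sigma>) * g n)"
proof (rule summable_comparison_test')
  show "summable (\<lambda>n. norm (of_real (c n) :: complex) * real n powr (-\<sigma>) * B)"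
    using c \<sigma> by (intro summable_mult2) (simp add: abs_conv_right_of_1_def)
  show "norm (c n * real n powr (-\<sigma>) * g n) \<le> norm (of_real (c n) :: complex) * real n powr (-\<sigma>) * B" for n
    using g[of n] by (simp add: abs_mult mult_left_mono)
qed

lemma summable_fejer:
  fixes c :: "nat \<Rightarrow> real"
  assumes c: "abs_conv_right_of_1 (\<lambda>n. of_real (c n))" and \<sigma>: "\<sigma> > 1"
  shows "summable (\<lambda>n. c n * real n powr (-\<sigma>) * fejer (T * (ln (real n) - y)))"
  by (rule summable_weighted[OF c \<sigma>, of _ 1]) (simp add: fejer_nonneg fejer_le_1)

lemma summable_cauchy_kernel:
  fixes c :: "nat \<Rightarrow> real"
  assumes c: "abs_conv_right_of_1 (\<lambda>n. of_real (c n))" and \<sigma>: "\<sigma> > 1"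
  shows "summable (\<lambda>n. c n * real n powr (-\<sigma>) * (1 / (1 + (ln (real n) - y)\<^sup>2)))"
  by (rule summable_weighted[OF c \<sigma>, of _ 1]) (simp add: divide_le_eq_1 add_pos_nonneg)

lemma abs_conv_right_of_1_mangoldt_real: "abs_conv_right_of_1 (\<lambda>n. of_real (mangoldt n))"
  using abs_conv_right_of_1_mangoldt by simp

lemma abs_conv_right_of_1_const_real: "abs_conv_right_of_1 (\<lambda>n. of_real 1)"
  using abs_conv_right_of_1_const by simp

lemma abs_conv_right_of_1_diff:
  assumes "abs_conv_right_of_1 a" "abs_conv_right_of_1 b"
  shows "abs_conv_right_of_1 (\<lambda>n. a n - b n)"
  unfolding abs_conv_right_of_1_def
proof (intro allI impI)
  fix \<sigma> :: real assume "\<sigma> > 1"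
  then have "summable (\<lambda>n. norm (a n) * real n powr (-\<sigma>) + norm (b n) * real n powr (-\<sigma>))"
    using assms by (intro summable_add) (auto simp: abs_conv_right_of_1_def)
  then show "summable (\<lambda>n. norm (a n - b n) * real n powr (-\<sigma>))"
    by (rule summable_comparison_test')
       (auto simp: distrib_right[symmetric] intro!: mult_right_mono norm_triangle_ineq4)
qed

lemma abs_conv_right_of_1_mangoldt_minus_one: "abs_conv_right_of_1 (\<lambda>n. of_real (mangoldt n - 1))"
  using abs_conv_right_of_1_diff[OF abs_conv_right_of_1_mangoldt abs_conv_right_of_1_const] by simp

lemma mangoldt_minus_one_fejer_bound:
  assumes T: "T > 0"
  obtains C where "C \<ge> 0" "\<And>\<sigma> y. 1 < \<sigma> \<Longrightarrow> \<sigma> \<le> 2 \<Longrightarrow> y > 0 \<Longrightarrow>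
     \<bar>(\<Sum>n. mangoldt n * real n powr (-\<sigma>) * fejer (T * (ln (real n) - y)))
       - (\<Sum>n. 1 * real n powr (-\<sigma>) * fejer (T * (ln (real n) - y)))\<bar> \<le> C / y"
proof -
  obtain U G where U: "open U" "{s. Re s \<ge> 1} \<subseteq> U" and G: "G holomorphic_on U"
    "\<And>s. Re s > 1 \<Longrightarrow> G s = mangoldt_series s - zeta_series s"
    by (rule mangoldt_minus_one_series_extends) blast
  have GD: "G s = dirichlet_series (\<lambda>n. of_real (mangoldt n - 1)) s" if s: "Re s > 1" for s
    using sums_diff[OF dirichlet_series_sums[OF abs_conv_right_of_1_mangoldt s]
        dirichlet_series_sums[OF abs_conv_right_of_1_const s]] G(2)[OF s]
    by (simp add: dirichlet_series_def sums_iff left_diff_distrib)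
  obtain C where C: "C \<ge> 0" "\<And>\<sigma> y. 1 < \<sigma> \<Longrightarrow> \<sigma> \<le> 2 \<Longrightarrow> y > 0 \<Longrightarrow>
     \<bar>\<Sum>n. (mangoldt n - 1) * real n powr (-\<sigma>) * fejer (T * (ln (real n) - y))\<bar> \<le> C / y"
    by (rule fejer_sum_bound[OF abs_conv_right_of_1_mangoldt_minus_one U G(1) GD T]) blast+
  have "(\<Sum>n. mangoldt n * real n powr (-\<sigma>) * fejer (T * (ln (real n) - y)))
       - (\<Sum>n. 1 * real n powr (-\<sigma>) * fejer (T * (ln (real n) - y)))
     = (\<Sum>n. (mangoldt n - 1) * real n powr (-\<sigma>) * fejer (T * (ln (real n) - y)))" if "\<sigma> > 1" for \<sigma> y
    using suminf_diff[OF summable_fejer[OF abs_conv_right_of_1_mangoldt_real that]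
        summable_fejer[OF abs_conv_right_of_1_const_real that]]
    by (simp add: left_diff_distrib)
  then show ?thesis using C by (intro that[of C]) auto
qed

section \<open>Cauchy kernel sums, compared with the integral of 1/(1 + u^2)\<close>

lemma arctan_diff_ge:
  assumes "a < b" "b - a \<le> 1"
  shows "(b - a) / (1 + b\<^sup>2) \<le> 3 * (arctan b - arctan a)"
proof -
  obtain z where z: "a < z" "z < b" "arctan b - arctan a = (b - a) * inverse (1 + z\<^sup>2)"
    using MVT2[OF assms(1), of arctan "\<lambda>z. inverse (1 + z\<^sup>2)"] DERIV_arctan by blast
  have "(z - b)\<^sup>2 \<le> 1" using z assms by (simp add: abs_square_le_1)
  moreover have "z\<^sup>2 \<le> 2 * b\<^sup>2 + 2 * (z - b)\<^sup>2"
    using zero_le_power2[of "2 * b - z"] by (simp add: power2_eq_square algebra_simps)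
  ultimately have "1 + z\<^sup>2 \<le> 3 * (1 + b\<^sup>2)" using zero_le_power2[of b] by argo
  then have "1 / (3 * (1 + b\<^sup>2)) \<le> 1 / (1 + z\<^sup>2)" by (intro divide_left_mono) (auto simp: add_pos_nonneg)
  then have "(b - a) * (1 / (3 * (1 + b\<^sup>2))) \<le> (b - a) * (1 / (1 + z\<^sup>2))" using assms by (intro mult_left_mono) auto
  also have "\<dots> = arctan b - arctan a" using z(3) by (simp add: inverse_eq_divide)
  finally have "3 * ((b - a) * (1 / (3 * (1 + b\<^sup>2)))) \<le> 3 * (arctan b - arctan a)"
    by (rule mult_left_mono) simp
  moreover have "3 * (d * (1 / (3 * q))) = d / q" for d q :: real by simp
  ultimately show ?thesis by metis
qed

text \<open>In the variable u = ln x - y the step from N to N + 1 has length between 1/(N + 1) and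
  1. On so short an interval the kernel is at least a third of its value at the right end, so a new
  term is at most 3 times an arctan increment.\<close>

lemma harmonic_cauchy_kernel_bound:
  "N > 0 \<Longrightarrow> (\<Sum>n=1..N. 1 / real n * (1 / (1 + (ln (real n) - y)\<^sup>2))) \<le> 1 + 3 * (arctan (ln (real N) - y) - arctan (- y))"
proof (induction N rule: nat_induct_non_zero)
  case 1
  show ?case by (simp add: divide_le_eq_1 add_pos_nonneg)
next
  case (Suc N)
  define a b where "a = ln (real N) - y" and "b = ln (real (Suc N)) - y"
  have N: "real N > 0" using Suc by simp
  have ba: "b - a = ln (1 + 1 / real N)"
  proof -
    have "1 + 1 / real N = real (Suc N) / real N" using N by (simp add: field_simps)
    then show ?thesis using N by (simp add: a_def b_def ln_div del: of_nat_Suc)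
  qed
  have "ln (1 + 1 / real N) \<le> 1 / real N" using N by (intro ln_add_one_self_le_self) auto
  also have "\<dots> \<le> 1" using N by simp
  finally have le: "b - a \<le> 1" by (simp add: ba)
  have "ln (real N / real (Suc N)) \<le> real N / real (Suc N) - 1" using N by (intro ln_le_minus_one) auto
  then have ge: "b - a \<ge> 1 / real (Suc N)" using N by (simp add: a_def b_def ln_div field_simps)
  have "1 / real (Suc N) * (1 / (1 + b\<^sup>2)) \<le> (b - a) * (1 / (1 + b\<^sup>2))"
    using ge by (intro mult_right_mono) auto
  also have "\<dots> \<le> 3 * (arctan b - arctan a)"
  proof -
    have "0 < 1 / real (Suc N)" by simp
    then have "a < b" using ge by linarith
    from arctan_diff_ge[OF this le] show ?thesis by simp
  qed
  finally show ?case using Suc.IH unfolding a_def b_def by (simp add: algebra_simps)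
qed

lemma sum_cauchy_kernel_bound:
  assumes \<sigma>: "\<sigma> > 1"
  shows "(\<Sum>n. 1 * real n powr (-\<sigma>) * (1 / (1 + (ln (real n) - y)\<^sup>2))) \<le> 13"
proof (rule suminf_le_const)
  show "summable (\<lambda>n. 1 * real n powr (-\<sigma>) * (1 / (1 + (ln (real n) - y)\<^sup>2)))"
    by (rule summable_cauchy_kernel[OF abs_conv_right_of_1_const_real \<sigma>])
next
  fix N :: nat
  have "(\<Sum>n<N. 1 * real n powr (-\<sigma>) * (1 / (1 + (ln (real n) - y)\<^sup>2)))
      \<le> (\<Sum>n\<le>Suc N. 1 * real n powr (-\<sigma>) * (1 / (1 + (ln (real n) - y)\<^sup>2)))"
    by (intro sum_mono2) auto
  also have "\<dots> = (\<Sum>n=1..Suc N. 1 * real n powr (-\<sigma>) * (1 / (1 + (ln (real n) - y)\<^sup>2)))"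
    by (intro sum.mono_neutral_right) auto
  also have "\<dots> \<le> (\<Sum>n=1..Suc N. 1 / real n * (1 / (1 + (ln (real n) - y)\<^sup>2)))"
  proof (intro sum_mono mult_right_mono)
    fix n assume n: "n \<in> {1..Suc N}"
    have "real n powr (-\<sigma>) \<le> real n powr (-1)" using n \<sigma> by (intro powr_mono) auto
    then show "1 * real n powr (-\<sigma>) \<le> 1 / real n" using n by (simp add: powr_minus_divide)
  qed auto
  also have "\<dots> \<le> 1 + 3 * (arctan (ln (real (Suc N)) - y) - arctan (- y))"
    by (rule harmonic_cauchy_kernel_bound) simp
  \<comment> \<open>13 = 1 + 3 * 4, because arctan varies by less than pi < 4.\<close>
  also have "\<dots> \<le> 13"
    using arctan_ubound[of "ln (real (Suc N)) - y"] arctan_lbound[of "- y"] pi_less_4 by argo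
  finally show "(\<Sum>n<N. 1 * real n powr (-\<sigma>) * (1 / (1 + (ln (real n) - y)\<^sup>2))) \<le> 13" .
qed

text \<open>As Lambda is nonnegative, closeness to the sum over all n bounds its mass near y. The
  Fejer kernel has zeros, so two copies shifted by pi are added to dominate a kernel without
  zeros.\<close>

lemma mangoldt_cauchy_kernel_bound:
  obtains C where "C > 0" "\<And>\<sigma> y. 1 < \<sigma> \<Longrightarrow> \<sigma> \<le> 2 \<Longrightarrow> y \<ge> 5 \<Longrightarrow>
    (\<Sum>n. mangoldt n * real n powr (-\<sigma>) * (1 / (1 + (ln (real n) - y)\<^sup>2))) \<le> C"
proof -
  define S where "S \<sigma> y = (\<Sum>n. mangoldt n * real n powr (-\<sigma>) * fejer (1 * (ln (real n) - y)))" for \<sigma> y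
  obtain C where C: "C \<ge> 0" "\<And>\<sigma> y. 1 < \<sigma> \<Longrightarrow> \<sigma> \<le> 2 \<Longrightarrow> y > 0 \<Longrightarrow>
     \<bar>S \<sigma> y - (\<Sum>n. 1 * real n powr (-\<sigma>) * fejer (1 * (ln (real n) - y)))\<bar> \<le> C / y"
    unfolding S_def by (rule mangoldt_minus_one_fejer_bound[of 1]) auto
  have S: "S \<sigma> y \<le> C + 65" if \<sigma>: "1 < \<sigma>" "\<sigma> \<le> 2" and y: "y \<ge> 1" for \<sigma> y
  proof -
    have "(\<Sum>n. 1 * real n powr (-\<sigma>) * fejer (1 * (ln (real n) - y)))
        \<le> (\<Sum>n. 5 * (1 * real n powr (-\<sigma>) * (1 / (1 + (ln (real n) - y)\<^sup>2))))"
    proof (rule suminf_le)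
      fix n
      have "real n powr (-\<sigma>) * fejer (ln (real n) - y) \<le> real n powr (-\<sigma>) * (5 / (1 + (ln (real n) - y)\<^sup>2))"
        by (intro mult_left_mono fejer_le) auto
      then show "1 * real n powr (-\<sigma>) * fejer (1 * (ln (real n) - y)) \<le> 5 * (1 * real n powr (-\<sigma>) * (1 / (1 + (ln (real n) - y)\<^sup>2)))"
        by (simp add: mult_ac)
    qed (intro summable_mult summable_fejer[OF abs_conv_right_of_1_const_real \<sigma>(1)]
          summable_cauchy_kernel[OF abs_conv_right_of_1_const_real \<sigma>(1)])+
    also have "\<dots> = 5 * (\<Sum>n. 1 * real n powr (-\<sigma>) * (1 / (1 + (ln (real n) - y)\<^sup>2)))"
      by (rule suminf_mult[OF summable_cauchy_kernel[OF abs_conv_right_of_1_const_real \<sigma>(1)]])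
    also have "\<dots> \<le> 5 * 13" by (intro mult_left_mono sum_cauchy_kernel_bound \<sigma>) auto
    finally have "(\<Sum>n. 1 * real n powr (-\<sigma>) * fejer (1 * (ln (real n) - y))) \<le> 65" by simp
    moreover have "C / y \<le> C / 1" using C(1) y by (intro divide_left_mono) auto
    ultimately show ?thesis using C(2)[OF \<sigma>, of y] y by linarith
  qed
  have "(\<Sum>n. mangoldt n * real n powr (-\<sigma>) * (1 / (1 + (ln (real n) - y)\<^sup>2))) \<le> 16 * (C + 65)"
    if \<sigma>: "1 < \<sigma>" "\<sigma> \<le> 2" and y: "y \<ge> 5" for \<sigma> y
  proof -
    let ?m = "\<lambda>n. mangoldt n * real n powr (-\<sigma>) * fejer (1 * (ln (real n) - y))"
    let ?m' = "\<lambda>n. mangoldt n * real n powr (-\<sigma>) * fejer (1 * (ln (real n) - (y - pi)))"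
    have s: "summable ?m" "summable ?m'"
      by (rule summable_fejer[OF abs_conv_right_of_1_mangoldt_real \<sigma>(1)])+
    have "(\<Sum>n. mangoldt n * real n powr (-\<sigma>) * (1 / (1 + (ln (real n) - y)\<^sup>2)))
        \<le> (\<Sum>n. 8 * (?m n + ?m' n))"
    proof (rule suminf_le)
      fix n
      let ?u = "ln (real n) - y"
      have "mangoldt n * real n powr (-\<sigma>) * (1 / (1 + ?u\<^sup>2))
          \<le> mangoldt n * real n powr (-\<sigma>) * (8 * (fejer ?u + fejer (?u + pi)))"
        by (intro mult_left_mono fejer_add_shift_ge) (auto simp: mangoldt_nonneg)
      also have "?u + pi = ln (real n) - (y - pi)" by simp
      finally show "mangoldt n * real n powr (-\<sigma>) * (1 / (1 + ?u\<^sup>2)) \<le> 8 * (?m n + ?m' n)"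
        by (simp add: algebra_simps)
    next
      show "summable (\<lambda>n. mangoldt n * real n powr (-\<sigma>) * (1 / (1 + (ln (real n) - y)\<^sup>2)))"
        by (rule summable_cauchy_kernel[OF abs_conv_right_of_1_mangoldt_real \<sigma>(1)])
      show "summable (\<lambda>n. 8 * (?m n + ?m' n))" by (intro summable_mult summable_add s)
    qed
    also have "\<dots> = 8 * (S \<sigma> y + S \<sigma> (y - pi))"
      unfolding S_def using s by (subst suminf_mult) (auto simp: suminf_add intro!: summable_add)
    \<comment> \<open>\<open>y \<ge> 5\<close> and pi < 4 keep the shifted centre
      \<open>y - pi\<close> at least 1.\<close>
    also have "\<dots> \<le> 8 * ((C + 65) + (C + 65))"
      using pi_less_4 y by (intro mult_left_mono add_mono S \<sigma>) auto
    finally show ?thesis by simp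
  qed
  then show ?thesis using C(1) by (intro that[of "16 * (C + 65)"]) auto
qed

text \<open>With \<sigma> = 1 + 1/y, n^(-\<sigma>) is at least exp (-(y + 3)) for all n between exp
  y and exp (y + 1/T). There the kernel is at least 1/2, and the window has at least exp y / T - 1
  integers.\<close>

lemma sum_fejer_ge:
  assumes T: "T \<ge> 1" and y: "y \<ge> 1"
  shows "(\<Sum>n. 1 * real n powr (-(1 + 1 / y)) * fejer (T * (ln (real n) - y))) \<ge> (1 / T - exp (- y)) * exp (-3) / 2"
proof -
  define a b where "a = nat \<lceil>exp y\<rceil>" and "b = nat \<lfloor>exp (y + 1 / T)\<rfloor>"
  have "exp y * (1 + 1 / T) \<le> exp y * exp (1 / T)" by (intro mult_left_mono exp_ge_add_one_self) auto
  then have "exp y / T \<le> exp (y + 1 / T) - exp y" by (simp add: exp_add algebra_simps)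
  moreover have "real a \<le> exp y + 1" "real b \<ge> exp (y + 1 / T) - 1" 
    using exp_gt_zero[of y] exp_gt_zero[of "y + 1 / T"] unfolding a_def b_def by (simp_all add: of_nat_nat)
  ultimately have "exp y / T - 1 \<le> real (Suc b) - real a" by simp
  also have "\<dots> \<le> real (card {a..b})" by simp
  finally have card: "exp y / T - 1 \<le> real (card {a..b})" .
  have "(1 / T - exp (- y)) * exp (-3) / 2 = (exp y / T - 1) * (exp (-(y + 3)) * (1 / 2))"
    by (simp add: algebra_simps flip: exp_add)
  also have "\<dots> \<le> real (card {a..b}) * (exp (-(y + 3)) * (1 / 2))" using card by (intro mult_right_mono) auto
  also have "\<dots> = (\<Sum>n\<in>{a..b}. exp (-(y + 3)) * (1 / 2))" by simp
  also have "\<dots> \<le> (\<Sum>n\<in>{a..b}. 1 * real n powr (-(1 + 1 / y)) * fejer (T * (ln (real n) - y)))"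
  proof (rule sum_mono)
    fix n assume n: "n \<in> {a..b}"
    have n1: "exp y \<le> real n" "real n \<le> exp (y + 1 / T)" using n unfolding a_def b_def
      by (auto simp: nat_le_iff le_nat_iff ceiling_le_iff le_floor_iff)
    have n0: "real n > 0" using n1(1) exp_gt_zero[of y] by linarith
    have l: "y \<le> ln (real n)" "ln (real n) \<le> y + 1 / T"
      using n1 n0 by (auto simp: ln_ge_iff ln_le_cancel_iff[of _ "exp (y + 1 / T)", simplified])
    have "ln (real n) * (1 + 1 / y) \<le> (y + 1 / T) * (1 + 1 / y)" using l y by (intro mult_right_mono) auto
    also have "\<dots> = y + 1 + 1 / T + 1 / T * (1 / y)" using y by (simp add: algebra_simps)
    also have "\<dots> \<le> y + 1 + 1 + 1 * 1" using T y by (intro add_mono mult_mono) auto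
    finally have "exp (-(y + 3)) \<le> real n powr (-(1 + 1 / y))" using n0 by (simp add: powr_def algebra_simps)
    moreover have "T * (ln (real n) - y) \<le> T * (1 / T)" using l T by (intro mult_left_mono) auto
    then have "fejer (T * (ln (real n) - y)) \<ge> 1 / 2" using l T by (intro fejer_ge_half) auto
    ultimately have "exp (-(y + 3)) * (1 / 2) \<le> real n powr (-(1 + 1 / y)) * fejer (T * (ln (real n) - y))"
      by (intro mult_mono) auto
    then show "exp (-(y + 3)) * (1 / 2) \<le> 1 * real n powr (-(1 + 1 / y)) * fejer (T * (ln (real n) - y))" by simp
  qed
  also have "\<dots> \<le> (\<Sum>n. 1 * real n powr (-(1 + 1 / y)) * fejer (T * (ln (real n) - y)))"
    using y by (intro sum_le_suminf summable_fejer[OF abs_conv_right_of_1_const_real]) (auto simp: fejer_nonneg)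
  finally show ?thesis .
qed

text \<open>Without prime powers within \<eta> of y, the Mangoldt sum sees only the kernel's tail
  and is O(1/T^2), while the sum over all n is of order 1/T and the two differ by O(1/y). The
  constant C0 must not depend on T, so it comes from a kernel of fixed width.\<close>

lemma primepow_log_dense_aux:
  assumes \<eta>: "0 < \<eta>" "\<eta> \<le> 1"
  shows "\<forall>\<^sub>F y in at_top. \<exists>q::nat. primepow q \<and> \<bar>ln (real q) - y\<bar> < \<eta>"
proof -
  obtain C0 where C0: "C0 > 0" "\<And>\<sigma> y. 1 < \<sigma> \<Longrightarrow> \<sigma> \<le> 2 \<Longrightarrow> y \<ge> 5 \<Longrightarrow>
    (\<Sum>n. mangoldt n * real n powr (-\<sigma>) * (1 / (1 + (ln (real n) - y)\<^sup>2))) \<le> C0"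
    by (rule mangoldt_cauchy_kernel_bound) blast
  \<comment> \<open>Makes the tail 8 C0 / (T^2 \<eta>^2) smaller than exp (-3) / (4 T), half of the
    main term; the summand 1 gives strictness and T \<ge> 1.\<close>
  define T where "T = 1 + 32 * exp 3 * C0 / \<eta>\<^sup>2"
  have T: "T \<ge> 1" unfolding T_def using C0(1) by simp
  have "8 * C0 / (T\<^sup>2 * \<eta>\<^sup>2) = (32 * exp 3 * C0 / \<eta>\<^sup>2) * (exp (-3) / (4 * T\<^sup>2))"
    by (simp add: exp_minus field_simps)
  also have "\<dots> < T * (exp (-3) / (4 * T\<^sup>2))"
    unfolding T_def using T by (intro mult_strict_right_mono) (auto simp: T_def)
  also have "\<dots> = exp (-3) / (4 * T)" by (simp add: power2_eq_square)
  finally have small: "8 * C0 / (T\<^sup>2 * \<eta>\<^sup>2) < exp (-3) / (4 * T)" .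
  obtain C where C: "C \<ge> 0" "\<And>\<sigma> y. 1 < \<sigma> \<Longrightarrow> \<sigma> \<le> 2 \<Longrightarrow> y > 0 \<Longrightarrow>
     \<bar>(\<Sum>n. mangoldt n * real n powr (-\<sigma>) * fejer (T * (ln (real n) - y)))
       - (\<Sum>n. 1 * real n powr (-\<sigma>) * fejer (T * (ln (real n) - y)))\<bar> \<le> C / y"
    using mangoldt_minus_one_fejer_bound[of T] T by auto
  have "((\<lambda>y. C / y + exp (- y) * (exp (-3) / 2)) \<longlongrightarrow> 0) at_top" by real_asymp
  then have "\<forall>\<^sub>F y in at_top. C / y + exp (- y) * (exp (-3) / 2) < exp (-3) / (4 * T)"
    using T by (intro order_tendstoD) auto
  moreover have "\<forall>\<^sub>F y::real in at_top. y \<ge> 5" by (rule eventually_ge_at_top)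
  ultimately show ?thesis
  proof eventually_elim
    case (elim y)
    show ?case
    proof (rule ccontr)
      assume "\<not> ?thesis"
      then have gap: "\<bar>ln (real q) - y\<bar> \<ge> \<eta>" if "primepow q" for q :: nat
        using that by (auto simp: not_less)
      define \<sigma> where "\<sigma> = 1 + 1 / y"
      have \<sigma>: "1 < \<sigma>" "\<sigma> \<le> 2" using elim by (auto simp: \<sigma>_def)
      let ?k = "\<lambda>n. mangoldt n * real n powr (-\<sigma>) * (1 / (1 + (ln (real n) - y)\<^sup>2))"
      have sk: "summable ?k"
        by (rule summable_cauchy_kernel[OF abs_conv_right_of_1_mangoldt_real \<sigma>(1)])
      have "(\<Sum>n. mangoldt n * real n powr (-\<sigma>) * fejer (T * (ln (real n) - y)))
          \<le> (\<Sum>n. 8 / (T\<^sup>2 * \<eta>\<^sup>2) * ?k n)"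
      proof (rule suminf_le)
        fix n
        show "mangoldt n * real n powr (-\<sigma>) * fejer (T * (ln (real n) - y)) \<le> 8 / (T\<^sup>2 * \<eta>\<^sup>2) * ?k n"
        proof (cases "primepow n")
          case True
          \<comment> \<open>From |v| \<ge> \<eta> and \<eta> \<le> 1 follows \<eta>^2 (1 + v^2)
            \<le> 2 v^2, so the decay 4 / (T v)^2 is dominated by a multiple of the Cauchy
            kernel.\<close>
          define v where "v = ln (real n) - y"
          have "\<eta>\<^sup>2 \<le> v\<^sup>2" using gap[OF True] \<eta> by (simp add: v_def abs_le_square_iff[symmetric])
          moreover have "\<eta>\<^sup>2 * v\<^sup>2 \<le> 1 * v\<^sup>2" using \<eta> by (intro mult_right_mono) (auto simp: power_le_one)
          ultimately have v: "\<eta>\<^sup>2 * (1 + v\<^sup>2) \<le> 2 * v\<^sup>2" by (simp add: distrib_left)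
          have "fejer (T * v) * (T\<^sup>2 * v\<^sup>2) \<le> 4"
            using fejer_mult_square[of "T * v"] cos_ge_minus_one[of "T * v"] unfolding power_mult_distrib by argo
          moreover have "fejer (T * v) * (T\<^sup>2 * (\<eta>\<^sup>2 * (1 + v\<^sup>2))) \<le> fejer (T * v) * (T\<^sup>2 * (2 * v\<^sup>2))"
            using v by (intro mult_left_mono fejer_nonneg) auto
          ultimately have "fejer (T * v) * (T\<^sup>2 * \<eta>\<^sup>2 * (1 + v\<^sup>2)) \<le> 8" by argo
          then have "fejer (T * v) \<le> 8 / (T\<^sup>2 * \<eta>\<^sup>2) * (1 / (1 + v\<^sup>2))"
            using T \<eta> by (simp add: pos_le_divide_eq add_pos_nonneg)
          then have "mangoldt n * real n powr (-\<sigma>) * fejer (T * v) \<le> mangoldt n * real n powr (-\<sigma>) * (8 / (T\<^sup>2 * \<eta>\<^sup>2) * (1 / (1 + v\<^sup>2)))"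
            by (intro mult_left_mono) (auto simp: mangoldt_nonneg)
          then show ?thesis by (simp add: v_def mult_ac)
        qed (simp add: mangoldt_def)
      next
        show "summable (\<lambda>n. mangoldt n * real n powr (-\<sigma>) * fejer (T * (ln (real n) - y)))"
          by (rule summable_fejer[OF abs_conv_right_of_1_mangoldt_real \<sigma>(1)])
        show "summable (\<lambda>n. 8 / (T\<^sup>2 * \<eta>\<^sup>2) * ?k n)" by (intro summable_mult sk)
      qed
      also have "\<dots> = 8 / (T\<^sup>2 * \<eta>\<^sup>2) * (\<Sum>n. ?k n)" by (rule suminf_mult[OF sk])
      also have "\<dots> \<le> 8 / (T\<^sup>2 * \<eta>\<^sup>2) * C0" using elim by (intro mult_left_mono C0 \<sigma>) auto
      finally have "(\<Sum>n. mangoldt n * real n powr (-\<sigma>) * fejer (T * (ln (real n) - y))) < exp (-3) / (4 * T)"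
        using small by simp
      moreover have "(\<Sum>n. 1 * real n powr (-\<sigma>) * fejer (T * (ln (real n) - y))) \<ge> (1 / T - exp (- y)) * exp (-3) / 2"
        unfolding \<sigma>_def using T elim by (intro sum_fejer_ge) auto
      moreover have "(1 / T - exp (- y)) * exp (-3) / 2 = 2 * (exp (-3) / (4 * T)) - exp (- y) * (exp (-3) / 2)"
        by (simp add: left_diff_distrib diff_divide_distrib)
      moreover have "y > 0" using elim by simp
      moreover have False if "A < e" "l \<le> B" "l = 2 * e - d" "- (A - B) \<le> c" "c + d < e" for A B c d e l :: real
        using that by linarith
      ultimately show False using abs_le_D2[OF C(2)[OF \<sigma>, of y]] elim(1) by blast
    qed
  qed
qed

lemma primepow_log_dense:
  assumes "\<eta> > 0"
  shows "\<forall>\<^sub>F y in at_top. \<exists>q::nat. primepow q \<and> \<bar>ln (real q) - y\<bar> < \<eta>"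
proof -
  have "\<forall>\<^sub>F y in at_top. \<exists>q::nat. primepow q \<and> \<bar>ln (real q) - y\<bar> < min \<eta> 1"
    using assms by (intro primepow_log_dense_aux) auto
  then show ?thesis by eventually_elim auto
qed

section \<open>The Frankl-Wilson bound for one forbidden distance\<close>

text \<open>Fraction-free Gaussian elimination with pivot \<open>M a0 b\<close>. The coefficients
  must be integers because they are divided by p repeatedly in the descent below.\<close>

lemma integer_linear_dependence:
  fixes M :: "'a \<Rightarrow> 'b \<Rightarrow> int"
  assumes "finite B" "finite A" "card B < card A"
  shows "\<exists>c. (\<exists>a\<in>A. c a \<noteq> 0) \<and> (\<forall>b\<in>B. (\<Sum>a\<in>A. c a * M a b) = 0)"
  using assms
proof (induction B arbitrary: A M rule: finite_induct)
  case empty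
  then obtain a where "a \<in> A" by fastforce
  then show ?case by (intro exI[of _ "\<lambda>_. 1"]) auto
next
  case (insert b B)
  show ?case
  proof (cases "\<forall>a\<in>A. M a b = 0")
    case True
    obtain c where "\<exists>a\<in>A. c a \<noteq> 0" "\<forall>b\<in>B. (\<Sum>a\<in>A. c a * M a b) = 0"
      using insert.IH[of A M] insert.prems insert.hyps by auto
    then show ?thesis using True by (intro exI[of _ c]) auto
  next
    case False
    then obtain a0 where a0: "a0 \<in> A" "M a0 b \<noteq> 0" by auto
    define M' where "M' a b' = M a0 b * M a b' - M a b * M a0 b'" for a b'
    let ?A = "A - {a0}"
    have "card B < card ?A" using insert.prems insert.hyps a0 by simp
    then obtain c where c: "\<exists>a\<in>?A. c a \<noteq> 0" "\<forall>b\<in>B. (\<Sum>a\<in>?A. c a * M' a b) = 0"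
      using insert.IH[of ?A M'] insert.prems by auto
    define c' where "c' a = (if a = a0 then - (\<Sum>a\<in>?A. c a * M a b) else M a0 b * c a)" for a
    have "(\<Sum>a\<in>A. c' a * M a b') = (\<Sum>a\<in>?A. c a * M' a b')" for b'
    proof -
      have "(\<Sum>a\<in>A. c' a * M a b') = c' a0 * M a0 b' + (\<Sum>a\<in>?A. c' a * M a b')"
        using insert.prems a0 by (subst sum.remove) auto
      also have "(\<Sum>a\<in>?A. c' a * M a b') = (\<Sum>a\<in>?A. M a0 b * c a * M a b')"
        by (intro sum.cong) (auto simp: c'_def)
      also have "c' a0 * M a0 b' + \<dots> = (\<Sum>a\<in>?A. c a * M' a b')"
        by (simp add: c'_def M'_def sum_distrib_left sum_distrib_right sum_subtractf sum_negf algebra_simps)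
      finally show ?thesis .
    qed
    moreover have "(\<Sum>a\<in>?A. c a * M' a b) = 0" by (intro sum.neutral) (simp add: M'_def)
    ultimately have "\<forall>b'\<in>insert b B. (\<Sum>a\<in>A. c' a * M a b') = 0" using c(2) by auto
    moreover have "\<exists>a\<in>A. c' a \<noteq> 0" using c(1) a0(2) by (auto simp: c'_def)
    ultimately show ?thesis by blast
  qed
qed

section \<open>Multilinear polynomials on the cube\<close>

definition small_subsets :: "nat \<Rightarrow> nat \<Rightarrow> nat set set" where
  "small_subsets m r = {I. I \<subseteq> {..<m} \<and> card I \<le> r}"

text \<open>\<open>of_bool (I \<subseteq> S)\<close> is the monomial with index set I at the
  indicator vector of S; these are the integer multilinear polynomials of degree at most r.\<close>

definition multilinear_deg_le :: "nat \<Rightarrow> nat \<Rightarrow> (nat set \<Rightarrow> int) \<Rightarrow> bool" where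
  "multilinear_deg_le m r f \<longleftrightarrow> (\<exists>a. \<forall>S. f S = (\<Sum>I\<in>small_subsets m r. a I * of_bool (I \<subseteq> S)))"

lemma finite_small_subsets: "finite (small_subsets m r)"
  by (rule finite_subset[of _ "Pow {..<m}"]) (auto simp: small_subsets_def)

lemma card_small_subsets: "card (small_subsets m r) = (\<Sum>i\<le>r. m choose i)"
proof -
  have "small_subsets m r = (\<Union>i\<le>r. {I. I \<subseteq> {..<m} \<and> card I = i})"
    by (auto simp: small_subsets_def)
  also have "card \<dots> = (\<Sum>i\<le>r. card {I. I \<subseteq> {..<m} \<and> card I = i})"
    by (rule card_UN_disjoint) auto
  finally show ?thesis by (simp add: n_subsets)
qed

lemma multilinear_basis:
  assumes "J \<in> small_subsets m r"
  shows "multilinear_deg_le m r (\<lambda>S. of_bool (J \<subseteq> S))"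
  unfolding multilinear_deg_le_def
  using assms finite_small_subsets[of m r]
  by (intro exI[of _ "\<lambda>I. of_bool (I = J)"]) (simp add: of_bool_def if_distrib[of "\<lambda>x. x * _"] sum.delta cong: if_cong)

lemma multilinear_add:
  assumes "multilinear_deg_le m r f" "multilinear_deg_le m r g"
  shows "multilinear_deg_le m r (\<lambda>S. f S + g S)"
proof -
  obtain a b where "\<And>S. f S = (\<Sum>I\<in>small_subsets m r. a I * of_bool (I \<subseteq> S))"
    "\<And>S. g S = (\<Sum>I\<in>small_subsets m r. b I * of_bool (I \<subseteq> S))"
    using assms unfolding multilinear_deg_le_def by metis
  then show ?thesis unfolding multilinear_deg_le_def
    by (intro exI[of _ "\<lambda>I. a I + b I"]) (simp add: distrib_right sum.distrib)
qed

lemma multilinear_cmult: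
  assumes "multilinear_deg_le m r f"
  shows "multilinear_deg_le m r (\<lambda>S. c * f S)"
proof -
  obtain a where "\<And>S. f S = (\<Sum>I\<in>small_subsets m r. a I * of_bool (I \<subseteq> S))"
    using assms unfolding multilinear_deg_le_def by metis
  then show ?thesis unfolding multilinear_deg_le_def
    by (intro exI[of _ "\<lambda>I. c * a I"]) (simp add: sum_distrib_left mult_ac)
qed

lemma multilinear_sum:
  assumes "finite A" "\<And>x. x \<in> A \<Longrightarrow> multilinear_deg_le m r (f x)"
  shows "multilinear_deg_le m r (\<lambda>S. \<Sum>x\<in>A. f x S)"
  using assms
proof (induction A rule: finite_induct)
  case empty
  show ?case by (auto simp: multilinear_deg_le_def intro!: exI[of _ "\<lambda>_. 0"])
qed (auto intro: multilinear_add)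

text \<open>On the cube x_i^2 = x_i, so multiplying a monomial by x_i replaces I by
  \<open>insert i I\<close>.\<close>

lemma multilinear_mult_indicator:
  assumes "multilinear_deg_le m r f" "i < m"
  shows "multilinear_deg_le m (Suc r) (\<lambda>S. f S * of_bool (i \<in> S))"
proof -
  obtain a where a: "\<And>S. f S = (\<Sum>I\<in>small_subsets m r. a I * of_bool (I \<subseteq> S))"
    using assms unfolding multilinear_deg_le_def by metis
  have eq: "(\<lambda>S. f S * of_bool (i \<in> S)) = (\<lambda>S. \<Sum>I\<in>small_subsets m r. a I * of_bool (insert i I \<subseteq> S))"
    by (auto simp: a sum_distrib_right fun_eq_iff intro!: sum.cong)
  show ?thesis
    unfolding eq
  proof (intro multilinear_sum multilinear_cmult multilinear_basis finite_small_subsets)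
    fix I assume "I \<in> small_subsets m r"
    then show "insert i I \<in> small_subsets m (Suc r)"
      using assms(2) card_insert_le_m1[of "Suc r" I i] by (auto simp: small_subsets_def)
  qed
qed

lemma multilinear_Suc:
  assumes "multilinear_deg_le m r f"
  shows "multilinear_deg_le m (Suc r) f"
proof -
  obtain a where a: "\<And>S. f S = (\<Sum>I\<in>small_subsets m r. a I * of_bool (I \<subseteq> S))"
    using assms unfolding multilinear_deg_le_def by metis
  have eq: "f = (\<lambda>S. \<Sum>I\<in>small_subsets m r. a I * of_bool (I \<subseteq> S))"
    by (simp add: a fun_eq_iff)
  show ?thesis
    unfolding eq
    by (intro multilinear_sum multilinear_cmult multilinear_basis finite_small_subsets)
       (auto simp: small_subsets_def)
qed

lemma multilinear_mult_affine:
  assumes "multilinear_deg_le m r f"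
  shows "multilinear_deg_le m (Suc r) (\<lambda>S. f S * (\<alpha> + (\<Sum>i<m. \<beta> i * of_bool (i \<in> S))))"
proof -
  have eq: "(\<lambda>S. f S * (\<alpha> + (\<Sum>i<m. \<beta> i * of_bool (i \<in> S)))) = (\<lambda>S. \<alpha> * f S + (\<Sum>i<m. \<beta> i * (f S * of_bool (i \<in> S))))"
    by (simp only: distrib_left sum_distrib_left mult_ac)
  show ?thesis
    unfolding eq
    by (intro multilinear_add multilinear_cmult multilinear_sum multilinear_mult_indicator multilinear_Suc assms) auto
qed

lemma multilinear_prod_affine:
  "multilinear_deg_le m r (\<lambda>S. \<Prod>j=1..r. (\<alpha> j + (\<Sum>i<m. \<beta> i * of_bool (i \<in> S))))"
proof (induction r)
  case 0
  have "multilinear_deg_le m 0 (\<lambda>S. of_bool ({} \<subseteq> S))"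
    by (rule multilinear_basis) (auto simp: small_subsets_def)
  then show ?case by simp
next
  case (Suc r)
  from multilinear_mult_affine[OF Suc, of "\<alpha> (Suc r)" \<beta>] show ?case by simp
qed

lemma card_sym_diff_add:
  assumes "finite S" "finite T"
  shows "card (sym_diff S T) + 2 * card (S \<inter> T) = card S + card T"
proof -
  have "card (sym_diff S T) = card (S - T) + card (T - S)"
    using assms by (intro card_Un_disjoint) auto
  moreover have "card S = card (S - T) + card (S \<inter> T)" "card T = card (T - S) + card (S \<inter> T)"
    using assms card_Diff_subset_Int[of S T] card_Diff_subset_Int[of T S] card_mono[of S "S \<inter> T"] card_mono[of T "S \<inter> T"]
    by (auto simp: Int_commute)
  ultimately show ?thesis by simp
qed

text \<open>Starting from card T at the empty set, an element of S raises the distance by 1 outside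
  T and lowers it by 1 inside T. Each such factor therefore has degree 1 in S.\<close>

lemma sym_diff_card_affine:
  fixes m :: nat
  assumes "S \<subseteq> {..<m}" "T \<subseteq> {..<m}"
  shows "int (card (sym_diff S T)) = int (card T) + (\<Sum>i<m. (1 - 2 * of_bool (i \<in> T)) * of_bool (i \<in> S))"
proof -
  have f: "finite S" "finite T"
    using assms by (meson finite_lessThan finite_subset)+
  have card: "(\<Sum>i<m. of_bool (i \<in> X)) = int (card X)" if "X \<subseteq> {..<m}" for X
    using that by (simp add: Int_absorb1)
  have "(\<Sum>i<m. (1 - 2 * of_bool (i \<in> T)) * of_bool (i \<in> S) :: int)
     = (\<Sum>i<m. of_bool (i \<in> S) - 2 * of_bool (i \<in> S \<inter> T))"
    by (intro sum.cong) auto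
  also have "\<dots> = (\<Sum>i<m. of_bool (i \<in> S)) - 2 * (\<Sum>i<m. of_bool (i \<in> S \<inter> T))"
    by (simp only: sum_subtractf sum_distrib_left)
  also have "\<dots> = int (card S) - 2 * int (card (S \<inter> T))"
    using assms by (subst (1 2) card) auto
  finally show ?thesis using card_sym_diff_add[OF f] by linarith
qed

text \<open>In q binom(k, q) = k binom(k - 1, q - 1), a last factor prime to p would force all of q
  = p^e to divide k.\<close>

lemma prime_dvd_binomial_primepow:
  fixes p :: nat
  assumes p: "prime p" and k: "k > 0" and q: "q = p ^ e" and nd: "\<not> q dvd k"
  shows "p dvd ((k - 1) choose (q - 1))"
proof (rule ccontr)
  assume "\<not> p dvd ((k - 1) choose (q - 1))"
  then have "coprime q ((k - 1) choose (q - 1))"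
    using p by (auto simp: q intro: prime_imp_coprime coprime_power_left_iff[THEN iffD2])
  moreover have "q > 0" using p by (auto simp: q prime_gt_0_nat)
  then have "q * (k choose q) = k * ((k - 1) choose (q - 1))"
    using Suc_times_binomial[of "q - 1" "k - 1"] k by simp
  then have "q dvd k * ((k - 1) choose (q - 1))" by (metis dvd_triv_left)
  ultimately show False using nd by (simp add: coprime_dvd_mult_left_iff)
qed

lemma prod_half_shift:
  assumes "k > 0"
  shows "(\<Prod>j=1..r. 2 * int k - 2 * int j) = 2 ^ r * fact r * int ((k - 1) choose r)"
proof -
  obtain l where l: "k = Suc l" using assms by (cases k) auto
  have "(\<Prod>j=1..r. 2 * int k - 2 * int j) = (\<Prod>j=1..r. 2 * (int k - int j))"
    by (simp add: right_diff_distrib)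
  also have "\<dots> = 2 ^ r * (\<Prod>j=1..r. int k - int j)" by (simp only: prod.distrib prod_constant card_atLeastAtMost) simp
  also have "(\<Prod>j=1..r. int k - int j) = (\<Prod>j=0..<r. int l - int j)"
    by (rule prod.reindex_bij_witness[of _ Suc "\<lambda>j. j - 1"]) (auto simp: l)
  also have "(\<Prod>j=0..<r. int l - int j) = fact r * int (l choose r)"
  proof -
    have "real_of_int (\<Prod>j=0..<r. int l - int j) = fact r * (real l gchoose r)"
      by (simp add: gbinomial_prod_rev)
    also have "\<dots> = real_of_int (fact r * int (l choose r))" by (simp add: binomial_gbinomial)
    finally show ?thesis unfolding of_int_eq_iff .
  qed
  finally show ?thesis by (simp add: l)
qed

(* N T S plays the role of binomial(h/2 - 1, q - 1) with h = |S symmetric_difference T|,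
   a polynomial in h that is a unit modulo p at h = 0 and divisible by p at the other distances. *)
lemma frankl_wilson_forbidden_distance:
  assumes q: "primepow q" and m: "m < 4 * q"
    and A: "\<And>S. S \<in> A \<Longrightarrow> S \<subseteq> {..<m} \<and> even (card S)"
    and forb: "\<And>S T. S \<in> A \<Longrightarrow> T \<in> A \<Longrightarrow> card (sym_diff S T) \<noteq> 2 * q"
  shows "card A \<le> (\<Sum>i<q. m choose i)"
proof (rule ccontr)
  assume neg: "\<not> ?thesis"
  obtain p e where p: "prime p" and e: "e > 0" and qp: "q = p ^ e" using q by (auto simp: primepow_def)
  have q0: "q > 0" using p by (auto simp: qp prime_gt_0_nat)
  have finA: "finite A" by (rule finite_subset[of _ "Pow {..<m}"]) (use A in auto)
  define r where "r = q - 1"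
  have "(\<Sum>i<q. m choose i) = card (small_subsets m r)"
    using q0 by (simp add: card_small_subsets r_def lessThan_Suc_atMost[symmetric])
  then have card: "card (small_subsets m r) < card A" using neg by simp
  \<comment> \<open>The product of h - 2j over j = 1, ..., q - 1, with the distance h of S and T in
    its affine form.\<close>
  define F where "F T S = (\<Prod>j=1..r. (int (card T) - 2 * int j) + (\<Sum>i<m. (1 - 2 * of_bool (i \<in> T)) * of_bool (i \<in> S)))" for T S :: "nat set"
  have "multilinear_deg_le m r (F T)" for T
    unfolding F_def by (rule multilinear_prod_affine)
  then obtain a where a: "\<And>T S. F T S = (\<Sum>I\<in>small_subsets m r. a T I * of_bool (I \<subseteq> S))"
    unfolding multilinear_deg_le_def by metis
  obtain c where c: "\<exists>T\<in>A. c T \<noteq> 0" "\<forall>I\<in>small_subsets m r. (\<Sum>T\<in>A. c T * a T I) = 0"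
    using integer_linear_dependence[OF finite_small_subsets finA card] by blast
  have cF: "(\<Sum>T\<in>A. c T * F T S) = 0" for S
  proof -
    have "(\<Sum>T\<in>A. c T * F T S) = (\<Sum>I\<in>small_subsets m r. (\<Sum>T\<in>A. c T * a T I) * of_bool (I \<subseteq> S))"
      by (subst sum_distrib_right, subst sum.swap) (simp add: a sum_distrib_left mult_ac)
    also have "\<dots> = 0" using c(2) by (intro sum.neutral) auto
    finally show ?thesis .
  qed
  \<comment> \<open>At \<open>T = S\<close> the intended value is binom(-1, r) = (-1)^r; it is
    stated separately because subtraction on naturals truncates.\<close>
  define N where "N T S = (if T = S then (-1) ^ r else int ((card (sym_diff S T) div 2 - 1) choose r))" for T S :: "nat set"
  have FN: "F T S = 2 ^ r * fact r * N T S" and Nd: "T \<noteq> S \<Longrightarrow> int p dvd N T S" if ST: "S \<in> A" "T \<in> A" for S T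
  proof -
    have F: "F T S = (\<Prod>j=1..r. int (card (sym_diff S T)) - 2 * int j)"
      unfolding F_def using sym_diff_card_affine[of S m T] A[OF ST(1)] A[OF ST(2)]
      by (intro prod.cong) auto
    have fin: "finite S" "finite T"
      using A[OF ST(1)] A[OF ST(2)] by (meson finite_lessThan finite_subset)+
    define k where "k = card (sym_diff S T) div 2"
    have "even (card (sym_diff S T) + 2 * card (S \<inter> T))"
      unfolding card_sym_diff_add[OF fin] using A[OF ST(1)] A[OF ST(2)] by simp
    then have k: "card (sym_diff S T) = 2 * k" by (simp add: k_def)
    have "F T S = 2 ^ r * fact r * N T S \<and> (T \<noteq> S \<longrightarrow> int p dvd N T S)"
    proof (cases "T = S")
      case True
      have "F T S = (\<Prod>j=1..r. (-2) * int j)" unfolding F using True by simp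
      also have "\<dots> = (-2) ^ r * fact r" by (simp add: prod.distrib fact_prod del: mult_minus_left)
      also have "\<dots> = 2 ^ r * fact r * N T S"
        using True by (simp add: N_def power_mult_distrib[symmetric])
      finally show ?thesis using True by simp
    next
      case False
      have "sym_diff S T \<noteq> {}" using False by auto
      then have k0: "k > 0" using k fin by (metis card_gt_0_iff finite_Diff finite_Un mult_is_0 not_gr0)
      have "card (sym_diff S T) \<le> card {..<m}" using A[OF ST(1)] A[OF ST(2)] by (intro card_mono) auto
      \<comment> \<open>From 0 < k < 2q, the only multiple of q that k could be is q itself, the
        forbidden case.\<close>
      then have "k < 2 * q" using k m by simp
      moreover have "k \<noteq> q" using forb[OF ST] k by simp
      ultimately have "\<not> q dvd k" using k0 by (auto simp: dvd_def)
      then have "p dvd ((k - 1) choose (q - 1))" by (rule prime_dvd_binomial_primepow[OF p k0 qp])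
      then have "int p dvd N T S" using False by (simp add: N_def r_def k_def)
      moreover have "F T S = 2 ^ r * fact r * N T S"
        unfolding F k using prod_half_shift[OF k0, of r] False by (simp add: N_def k_def)
      ultimately show ?thesis by blast
    qed
    then show "F T S = 2 ^ r * fact r * N T S" "T \<noteq> S \<Longrightarrow> int p dvd N T S" by blast+
  qed
  \<comment> \<open>The factor 2^r r! may be divisible by p, so it is cancelled over the integers
    before reducing modulo p.\<close>
  have cN: "(\<Sum>T\<in>A. c T * N T S) = 0" if S: "S \<in> A" for S
  proof -
    have "(2 ^ r * fact r) * (\<Sum>T\<in>A. c T * N T S) = (\<Sum>T\<in>A. c T * F T S)"
      unfolding sum_distrib_left by (intro sum.cong) (simp_all add: FN[OF S])
    then show ?thesis using cF[of S] by simp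
  qed
  \<comment> \<open>Modulo p the matrix N is diagonal with entries 1 or -1, so p divides every
    coefficient of a relation. The quotients satisfy the same relation, and the argument
    repeats.\<close>
  have descent: "\<forall>T\<in>A. int p ^ k dvd c T" if "\<forall>S\<in>A. (\<Sum>T\<in>A. c T * N T S) = 0" for c k
    using that
  proof (induction k arbitrary: c)
    case (Suc k)
    have dv: "int p dvd c S" if S: "S \<in> A" for S
    proof -
      have "(\<Sum>T\<in>A. c T * N T S) = c S * N S S + (\<Sum>T\<in>A-{S}. c T * N T S)"
        using finA S by (rule sum.remove)
      moreover have "int p dvd (\<Sum>T\<in>A-{S}. c T * N T S)"
        using Nd[OF S] by (intro dvd_sum) auto
      moreover have "(\<Sum>T\<in>A. c T * N T S) = 0" using Suc.prems S by blast
      ultimately have "int p dvd c S * N S S" by (metis dvd_0_right dvd_add_left_iff)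
      then show ?thesis by (cases "even r") (auto simp: N_def)
    qed
    define c' where "c' T = c T div int p" for T
    have c': "c T = int p * c' T" if "T \<in> A" for T using dv[OF that] by (simp add: c'_def)
    have "\<forall>S\<in>A. (\<Sum>T\<in>A. c' T * N T S) = 0"
    proof
      fix S assume S: "S \<in> A"
      have "int p * (\<Sum>T\<in>A. c' T * N T S) = (\<Sum>T\<in>A. c T * N T S)"
        unfolding sum_distrib_left by (intro sum.cong) (auto simp: c')
      also have "\<dots> = 0" using Suc.prems S by blast
      finally show "(\<Sum>T\<in>A. c' T * N T S) = 0" using p by (auto simp: prime_gt_0_nat)
    qed
    from Suc.IH[OF this] show ?case using c' by auto
  qed auto
  obtain T where T: "T \<in> A" "c T \<noteq> 0" using c(1) by blast
  \<comment> \<open>A nonzero integer c is not divisible by p^|c|, since |c| < p^|c|.\<close>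
  have "int p ^ nat \<bar>c T\<bar> dvd c T" using descent[of c "nat \<bar>c T\<bar>"] cN T by blast
  then have "\<bar>int p ^ nat \<bar>c T\<bar>\<bar> \<le> \<bar>c T\<bar>" using T by (intro dvd_imp_le_int) auto
  then have "int (p ^ nat \<bar>c T\<bar>) \<le> int (nat \<bar>c T\<bar>)" by simp
  then have "p ^ nat \<bar>c T\<bar> \<le> nat \<bar>c T\<bar>" by linarith
  moreover have "nat \<bar>c T\<bar> < p ^ nat \<bar>c T\<bar>" using prime_gt_1_nat[OF p] by (intro power_gt_expt) auto
  ultimately show False by simp
qed

section \<open>Cube points on the sphere\<close>

text \<open>Coordinate m has the same value d at all points: it brings the norm up to r and cancels
  in every distance.\<close>

definition cube_point :: "real \<Rightarrow> real \<Rightarrow> nat \<Rightarrow> nat set \<Rightarrow> nat \<Rightarrow> real" where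
  "cube_point c d m S i = (if i < m then if i \<in> S then - c else c else if i = m then d else 0)"

lemma cube_point_in_sphere:
  assumes "r \<ge> 0" "real m * c\<^sup>2 + d\<^sup>2 = r\<^sup>2"
  shows "cube_point c d m S \<in> euclid_sphere (Suc m) r"
proof -
  have "(\<Sum>i<m. (cube_point c d m S i)\<^sup>2) = (\<Sum>i<m. c\<^sup>2)"
    by (intro sum.cong) (auto simp: cube_point_def)
  then have "(\<Sum>i<Suc m. (cube_point c d m S i)\<^sup>2) = r\<^sup>2"
    using assms by (simp add: cube_point_def)
  then show ?thesis
    using assms(1) by (simp add: euclid_sphere_def topspace_Euclidean_space L2_set_def) (simp add: cube_point_def)
qed

lemma euclid_dist_cube_point:
  assumes "c \<ge> 0" "S \<subseteq> {..<m}" "T \<subseteq> {..<m}"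
  shows "euclid_dist (Suc m) (cube_point c d m S) (cube_point c d m T) = 2 * c * sqrt (real (card (sym_diff S T)))"
proof -
  have "(\<Sum>i<m. (cube_point c d m S i - cube_point c d m T i)\<^sup>2) = (\<Sum>i<m. (2 * c)\<^sup>2 * of_bool (i \<in> sym_diff S T))"
    by (intro sum.cong) (auto simp: cube_point_def power2_eq_square)
  also have "\<dots> = (2 * c)\<^sup>2 * real (card ({..<m} \<inter> sym_diff S T))"
    by (simp add: sum_distrib_left[symmetric] of_bool_def sum.If_cases Int_def)
  also have "{..<m} \<inter> sym_diff S T = sym_diff S T" using assms by auto
  finally have "euclid_dist (Suc m) (cube_point c d m S) (cube_point c d m T) = sqrt ((2 * c)\<^sup>2 * real (card (sym_diff S T)))"
    by (simp add: euclid_dist_def L2_set_def cube_point_def)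
  then show ?thesis using assms(1) by (simp add: real_sqrt_mult)
qed

text \<open>The element m - 1 acts as a parity bit, added to the subsets of
  \<open>{..<m - 1}\<close> of odd size.\<close>

lemma card_even_subsets_ge:
  assumes "m > 0"
  shows "2 ^ (m - 1) \<le> card {S. S \<subseteq> {..<m} \<and> even (card S)}"
proof -
  define g where "g S = (if even (card S) then S else insert (m - 1) S)" for S
  have inj: "inj_on g (Pow {..<m - 1})"
  proof (rule inj_on_inverseI[where g = "\<lambda>S. S - {m - 1}"])
    fix S assume "S \<in> Pow {..<m - 1}"
    then show "g S - {m - 1} = S" by (auto simp: g_def)
  qed
  have "g S \<subseteq> {..<m} \<and> even (card (g S))" if "S \<subseteq> {..<m - 1}" for S
  proof -
    have "finite S" "m - 1 \<notin> S" using that finite_subset by auto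
    then show ?thesis using that assms by (auto simp: g_def)
  qed
  then have "g ` Pow {..<m - 1} \<subseteq> {S. S \<subseteq> {..<m} \<and> even (card S)}" by auto
  moreover have "finite {S. S \<subseteq> {..<m} \<and> even (card S)}"
    by (rule finite_subset[of _ "Pow {..<m}"]) auto
  ultimately have "card (g ` Pow {..<m - 1}) \<le> card {S. S \<subseteq> {..<m} \<and> even (card S)}"
    by (intro card_mono)
  then show ?thesis unfolding card_image[OF inj] by (simp add: card_Pow)
qed

text \<open>Each part holds at most as many even-weight cube points as the Frankl-Wilson bound
  allows, and together the parts cover at least 2^(m - 1) of them.\<close>

lemma partition_card_lower_bound:
  assumes q: "primepow q" and m: "0 < m" "m < 4 * q" and r: "r \<ge> 0" "real m \<le> 8 * r\<^sup>2 * real q"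
    and P: "finite P" "partition_on (euclid_sphere (Suc m) r) P" "\<forall>A\<in>P. unit_distance_free (Suc m) A"
  shows "2 ^ (m - 1) \<le> card P * (\<Sum>i<q. m choose i)"
proof -
  have q0: "q > 0" using m by auto
  define c where "c = 1 / sqrt (8 * real q)"
  \<comment> \<open>The radicand is nonnegative exactly because m \<le> 8 r^2 q.\<close>
  define d where "d = sqrt (r\<^sup>2 - real m * c\<^sup>2)"
  have c2: "c\<^sup>2 = 1 / (8 * real q)" and c0: "c \<ge> 0" using q0 by (auto simp: c_def power_divide)
  have "real m * c\<^sup>2 \<le> r\<^sup>2" using r(2) q0 by (simp add: c2 field_simps)
  then have d: "real m * c\<^sup>2 + d\<^sup>2 = r\<^sup>2" by (simp add: d_def)
  let ?x = "cube_point c d m"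
  define E where "E = {S. S \<subseteq> {..<m} \<and> even (card S)}"
  have "\<exists>A\<in>P. ?x S \<in> A" for S
    using cube_point_in_sphere[OF r(1) d] P(2) by (auto simp: partition_on_def)
  then have E: "E = (\<Union>A\<in>P. {S \<in> E. ?x S \<in> A})" by auto
  have "card {S \<in> E. ?x S \<in> A} \<le> (\<Sum>i<q. m choose i)" if A: "A \<in> P" for A
  proof (rule frankl_wilson_forbidden_distance[OF q m(2)])
    fix S T assume ST: "S \<in> {S \<in> E. ?x S \<in> A}" "T \<in> {S \<in> E. ?x S \<in> A}"
    show "card (sym_diff S T) \<noteq> 2 * q"
    proof
      assume "card (sym_diff S T) = 2 * q"
      then have "euclid_dist (Suc m) (?x S) (?x T) = 2 * c * sqrt (2 * real q)"
        using euclid_dist_cube_point[OF c0, of S m T d] ST by (simp add: E_def)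
      also have "\<dots> = sqrt ((2 * c)\<^sup>2) * sqrt (2 * real q)"
        using c0 unfolding real_sqrt_abs by simp
      also have "\<dots> = sqrt ((2 * c)\<^sup>2 * (2 * real q))" by (rule real_sqrt_mult[symmetric])
      also have "\<dots> = 1" using q0 by (simp add: power_mult_distrib c2)
      finally show False using P(3) A ST by (auto simp: unit_distance_free_def)
    qed
  qed (auto simp: E_def)
  then have "(\<Sum>A\<in>P. card {S \<in> E. ?x S \<in> A}) \<le> (\<Sum>A\<in>P. \<Sum>i<q. m choose i)" by (rule sum_mono)
  moreover have "card E \<le> (\<Sum>A\<in>P. card {S \<in> E. ?x S \<in> A})"
    by (subst E) (rule card_UN_le[OF P(1)])
  moreover have "2 ^ (m - 1) \<le> card E" unfolding E_def by (rule card_even_subsets_ge[OF m(1)])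
  ultimately show ?thesis by simp
qed

text \<open>This is exp (-H(b)) for the binary entropy H in natural logarithms; twice its value at
  1/(8 r^2) is the base in the theorem.\<close>

definition binary_entropy_exp :: "real \<Rightarrow> real" where
  "binary_entropy_exp b = b powr b * (1 - b) powr (1 - b)"

text \<open>Comparison with the expansion of (b + (1 - b))^m = 1 at b = q/m. As b \<le> 1 - b,
  replacing factors b by 1 - b can only increase a product, so b^q (1 - b)^(m - q) \<le> b^i (1 -
  b)^(m - i) for i < q.\<close>

lemma sum_binomial_le_entropy:
  assumes q: "0 < q" "2 * q \<le> m"
  shows "real (\<Sum>i<q. m choose i) * binary_entropy_exp (real q / real m) ^ m \<le> 1"
proof -
  define b where "b = real q / real m"
  have m: "real m > 0" using q by simp
  have b: "0 < b" "b \<le> 1 / 2" using q m by (auto simp: b_def field_simps)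
  have "binary_entropy_exp b ^ m = (b powr b) ^ m * ((1 - b) powr (1 - b)) ^ m"
    by (simp add: binary_entropy_exp_def power_mult_distrib)
  also have "(b powr b) ^ m = b ^ q"
    using b m by (simp add: powr_powr powr_realpow[symmetric]) (simp add: b_def)
  also have "((1 - b) powr (1 - b)) ^ m = (1 - b) ^ (m - q)"
  proof -
    have "(1 - b) * real m = real (m - q)" using q m by (simp add: b_def field_simps of_nat_diff)
    then show ?thesis using b by (simp add: powr_powr powr_realpow[symmetric] del: of_nat_diff)
  qed
  finally have ent: "binary_entropy_exp b ^ m = b ^ q * (1 - b) ^ (m - q)" .
  have "real (\<Sum>i<q. m choose i) * (b ^ q * (1 - b) ^ (m - q)) = (\<Sum>i<q. real (m choose i) * (b ^ q * (1 - b) ^ (m - q)))"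
    by (simp add: sum_distrib_right)
  also have "\<dots> \<le> (\<Sum>i<q. real (m choose i) * b ^ i * (1 - b) ^ (m - i))"
  proof (rule sum_mono)
    fix i assume i: "i \<in> {..<q}"
    have "b ^ q * (1 - b) ^ (m - q) = b ^ i * (b ^ (q - i) * (1 - b) ^ (m - q))"
      using i by (simp add: power_add[symmetric] mult.assoc[symmetric])
    also have "\<dots> \<le> b ^ i * ((1 - b) ^ (q - i) * (1 - b) ^ (m - q))"
      using b by (intro mult_left_mono mult_right_mono power_mono) auto
    also have "(1 - b) ^ (q - i) * (1 - b) ^ (m - q) = (1 - b) ^ (m - i)"
      using i q by (simp add: power_add[symmetric])
    finally show "real (m choose i) * (b ^ q * (1 - b) ^ (m - q)) \<le> real (m choose i) * b ^ i * (1 - b) ^ (m - i)"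
      by (simp add: mult.assoc mult_left_mono)
  qed
  also have "\<dots> \<le> (\<Sum>i\<le>m. real (m choose i) * b ^ i * (1 - b) ^ (m - i))"
    using q b by (intro sum_mono2) auto
  also have "\<dots> = 1" using binomial_ring[of b "1 - b" m] by simp
  finally show ?thesis using ent by (simp only: b_def)
qed

lemma ereal_le_sphere_chromatic_number:
  assumes "\<And>P. finite P \<Longrightarrow> partition_on (euclid_sphere n r) P \<Longrightarrow> \<forall>A\<in>P. unit_distance_free n A \<Longrightarrow> x \<le> real (card P)"
  shows "ereal x \<le> ereal_of_enat (sphere_chromatic_number n r)"
proof -
  let ?X = "{enat (card P) |P. finite P \<and> partition_on (euclid_sphere n r) P \<and> (\<forall>A\<in>P. unit_distance_free n A)}"
  show ?thesis
  proof (cases "?X = {}")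
    case True
    then show ?thesis unfolding sphere_chromatic_number_def True by (simp add: Inf_enat_def)
  next
    case False
    then have "Inf ?X \<in> ?X" unfolding Inf_enat_def using LeastI_ex[of "\<lambda>k. k \<in> ?X"] by (auto simp del: mem_Collect_eq)
    then obtain P where "Inf ?X = enat (card P)" "finite P" "partition_on (euclid_sphere n r) P" "\<forall>A\<in>P. unit_distance_free n A"
      by blast
    then show ?thesis unfolding sphere_chromatic_number_def using assms[of P] by simp
  qed
qed

lemma sphere_chromatic_number_lower_bound:
  assumes q: "primepow q" and m: "0 < m" "2 * q \<le> m" "m < 4 * q" and r: "r \<ge> 0" "real m \<le> 8 * r\<^sup>2 * real q"
  shows "ereal_of_enat (sphere_chromatic_number (Suc m) r) \<ge> ereal ((2 * binary_entropy_exp (real q / real m)) ^ m / 2)"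
proof (rule ereal_le_sphere_chromatic_number)
  fix P assume P: "finite P" "partition_on (euclid_sphere (Suc m) r) P" "\<forall>A\<in>P. unit_distance_free (Suc m) A"
  define W where "W = real (\<Sum>i<q. m choose i)"
  define h where "h = binary_entropy_exp (real q / real m) ^ m"
  have q0: "q > 0" using m by auto
  have "2 ^ (m - 1) \<le> card P * (\<Sum>i<q. m choose i)" by (rule partition_card_lower_bound[OF q m(1,3) r P])
  then have le: "real (2 ^ (m - 1)) \<le> real (card P) * W" unfolding W_def of_nat_mult[symmetric] by (rule of_nat_mono)
  have "h \<ge> 0" by (simp add: h_def binary_entropy_exp_def)
  from mult_right_mono[OF le this] have "2 ^ (m - 1) * h \<le> real (card P) * (W * h)"
    by (simp add: mult.assoc)
  also have "\<dots> \<le> real (card P) * 1"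
    unfolding W_def h_def using q0 m by (intro mult_left_mono sum_binomial_le_entropy) auto
  finally have "2 ^ (m - 1) * h \<le> real (card P)" by simp
  also have "2 ^ (m - 1) * h = (2 * binary_entropy_exp (real q / real m)) ^ m / 2"
    using m(1) by (cases m) (simp_all add: h_def power_mult_distrib)
  finally show "(2 * binary_entropy_exp (real q / real m)) ^ m / 2 \<le> real (card P)" .
qed

lemma primepow_sequence:
  assumes a: "a > 0"
  obtains q :: "nat \<Rightarrow> nat" where "(\<lambda>m. real (q m) / real m) \<longlonglongrightarrow> a"
    "\<forall>\<^sub>F m in sequentially. primepow (q m) \<and> a * real m \<le> real (q m)"
proof -
  \<comment> \<open>For the least prime power from a m on, the lower bound holds as soon as a
    candidate exists, and every candidate is an upper bound.\<close>
  define q where "q m = (LEAST q. primepow q \<and> a * real m \<le> real q)" for m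
  have key: "\<forall>\<^sub>F m in sequentially. primepow (q m) \<and> a * real m \<le> real (q m) \<and> real (q m) < a * real m * exp (2 * \<eta>)"
    if \<eta>: "\<eta> > 0" for \<eta>
  proof -
    \<comment> \<open>Centre ln (a m) + \<eta> and radius \<eta> place the prime power between a m
      and a m exp (2 \<eta>), on the required side.\<close>
    have "filterlim (\<lambda>m. ln (a * real m) + \<eta>) at_top sequentially" using a by real_asymp
    from eventually_compose_filterlim[OF primepow_log_dense[OF \<eta>] this]
    have "\<forall>\<^sub>F m in sequentially. \<exists>q::nat. primepow q \<and> \<bar>ln (real q) - (ln (a * real m) + \<eta>)\<bar> < \<eta>" .
    moreover have "\<forall>\<^sub>F m::nat in sequentially. m > 0" by (rule eventually_gt_at_top)
    ultimately show ?thesis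
    proof eventually_elim
      case (elim m)
      then obtain s :: nat where s: "primepow s" "\<bar>ln (real s) - (ln (a * real m) + \<eta>)\<bar> < \<eta>" by blast
      have am: "a * real m > 0" using a elim by simp
      have s0: "real s > 0" using primepow_gt_0_nat[OF s(1)] by simp
      have "ln (a * real m) < ln (real s)" "ln (real s) < ln (a * real m * exp (2 * \<eta>))"
        using s(2) am by (auto simp: ln_mult abs_less_iff)
      then have s2: "a * real m < real s" "real s < a * real m * exp (2 * \<eta>)" using am s0 by auto
      have "primepow (q m) \<and> a * real m \<le> real (q m)"
        unfolding q_def by (rule LeastI[of _ s]) (use s s2 in auto)
      moreover have "q m \<le> s" unfolding q_def by (rule Least_le) (use s s2 in auto)
      ultimately show ?case using s2 by auto
    qed
  qed
  have "(\<lambda>m. real (q m) / real m) \<longlonglongrightarrow> a"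
  proof (rule order_tendstoI)
    fix b assume b: "b < a"
    from key[of 1] have "\<forall>\<^sub>F m in sequentially. primepow (q m) \<and> a * real m \<le> real (q m) \<and> real (q m) < a * real m * exp (2 * 1)" by simp
    moreover have "\<forall>\<^sub>F m::nat in sequentially. m > 0" by (rule eventually_gt_at_top)
    ultimately show "\<forall>\<^sub>F m in sequentially. b < real (q m) / real m"
    proof eventually_elim
      case (elim m)
      then have "a \<le> real (q m) / real m" by (simp add: pos_le_divide_eq)
      with b show ?case by simp
    qed
  next
    fix b assume b: "a < b"
    define \<eta> where "\<eta> = ln (b / a) / 2"
    have \<eta>: "\<eta> > 0" "a * exp (2 * \<eta>) = b" using a b by (auto simp: \<eta>_def)
    have "\<forall>\<^sub>F m::nat in sequentially. m > 0" by (rule eventually_gt_at_top)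
    with key[OF \<eta>(1)] show "\<forall>\<^sub>F m in sequentially. real (q m) / real m < b"
    proof eventually_elim
      case (elim m)
      then have "real (q m) < (a * exp (2 * \<eta>)) * real m" by (simp add: mult_ac)
      then show ?case using elim unfolding \<eta>(2) by (simp add: pos_divide_less_eq)
    qed
  qed
  moreover have "\<forall>\<^sub>F m in sequentially. primepow (q m) \<and> a * real m \<le> real (q m)"
    using key[of 1] by (auto elim: eventually_mono)
  ultimately show ?thesis using that by blast
qed

text \<open>The exponents m/(m + 1) and the roots of the factor 1/2 both tend to 1, so the spare
  coordinate and the restriction to even weight leave the rate unchanged.\<close>

lemma tendsto_root_of_shifted_power:
  fixes f :: "nat \<Rightarrow> real"
  assumes f: "f \<longlonglongrightarrow> L" and L: "L > 0"
  shows "(\<lambda>m. (f m ^ m / 2) powr (1 / real (Suc m))) \<longlonglongrightarrow> L"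
proof -
  have "(\<lambda>m. exp (ln (f m) * (real m / real (Suc m)) - ln 2 / real (Suc m))) \<longlonglongrightarrow> exp (ln L * 1 - 0)"
  proof (intro tendsto_intros f)
    show "(\<lambda>m. real m / real (Suc m)) \<longlonglongrightarrow> 1" by real_asymp
    show "(\<lambda>m. ln 2 / real (Suc m)) \<longlonglongrightarrow> 0" by real_asymp
  qed (use L in auto)
  then have "(\<lambda>m. exp (ln (f m) * (real m / real (Suc m)) - ln 2 / real (Suc m))) \<longlonglongrightarrow> L" using L by simp
  moreover have "\<forall>\<^sub>F m in sequentially. f m > 0" using order_tendstoD(1)[OF f L] .
  then have "\<forall>\<^sub>F m in sequentially. exp (ln (f m) * (real m / real (Suc m)) - ln 2 / real (Suc m)) = (f m ^ m / 2) powr (1 / real (Suc m))"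
    by eventually_elim (simp add: powr_def ln_div ln_realpow diff_divide_distrib mult_ac)
  ultimately show ?thesis by (rule Lim_transform_eventually)
qed

theorem theorem2:
  fixes r :: real
  assumes "1 / 2 < r" and "r < 1 / sqrt 2"
  shows "\<exists>\<delta> :: nat \<Rightarrow> real. \<delta> \<longlonglongrightarrow> 0 \<and>
    (\<forall>n\<ge>1. ereal_of_enat (sphere_chromatic_number n r) \<ge>
       ereal ((2 * (1 / (8 * r\<^sup>2)) powr (1 / (8 * r\<^sup>2))
                 * (1 - 1 / (8 * r\<^sup>2)) powr (1 - 1 / (8 * r\<^sup>2)) + \<delta> n) ^ n))"
proof -
  define a where "a = 1 / (8 * r\<^sup>2)"
  have r0: "r > 0" using assms(1) by simp
  have "(1 / 2)\<^sup>2 < r\<^sup>2" using assms(1) by (intro power_strict_mono) auto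
  moreover have "r\<^sup>2 < (1 / sqrt 2)\<^sup>2" using assms(2) r0 by (intro power_strict_mono) auto
  ultimately have r2: "1 / 4 < r\<^sup>2" "r\<^sup>2 < 1 / 2" by (auto simp: power_divide)
  \<comment> \<open>The upper bound on r gives a > 1/4 and later m < 4q; the lower bound gives a <
    1/2 and later 2q \<le> m.\<close>
  have a: "1 / 4 < a" "a < 1 / 2" using r2 r0 by (auto simp: a_def field_simps)
  define B where "B = 2 * binary_entropy_exp a"
  obtain q :: "nat \<Rightarrow> nat" where q: "(\<lambda>m. real (q m) / real m) \<longlonglongrightarrow> a"
    "\<forall>\<^sub>F m in sequentially. primepow (q m) \<and> a * real m \<le> real (q m)"
    by (rule primepow_sequence[of a]) (use a in auto)
  define f where "f m = 2 * binary_entropy_exp (real (q m) / real m)" for m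
  have "f \<longlonglongrightarrow> B"
    unfolding f_def[abs_def] B_def binary_entropy_exp_def using a by (intro tendsto_intros q) auto
  moreover have "B > 0" using a by (simp add: B_def binary_entropy_exp_def)
  ultimately have lim: "(\<lambda>m. (f m ^ m / 2) powr (1 / real (Suc m))) \<longlonglongrightarrow> B"
    by (rule tendsto_root_of_shifted_power)
  have "\<forall>\<^sub>F m in sequentially. real (q m) / real m < 1 / 2" using order_tendstoD(2)[OF q(1) a(2)] .
  moreover have "\<forall>\<^sub>F m::nat in sequentially. m > 0" by (rule eventually_gt_at_top)
  ultimately have "\<forall>\<^sub>F m in sequentially. ereal_of_enat (sphere_chromatic_number (Suc m) r) \<ge> ereal (f m ^ m / 2)"
    using q(2)
  proof eventually_elim
    case (elim m)
    show ?case
      unfolding f_def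
    proof (rule sphere_chromatic_number_lower_bound)
      show "2 * q m \<le> m" using elim by (simp add: field_simps)
      have "1 / 4 * real m < a * real m" using a elim by (intro mult_strict_right_mono) auto
      moreover have "a * real m \<le> real (q m)" using elim by blast
      ultimately have "real m < 4 * real (q m)" by argo
      then show "m < 4 * q m" by simp
      show "real m \<le> 8 * r\<^sup>2 * real (q m)" using elim r0 by (simp add: a_def field_simps)
    qed (use elim r0 in auto)
  qed
  then obtain M where M: "\<And>m. m \<ge> M \<Longrightarrow> ereal_of_enat (sphere_chromatic_number (Suc m) r) \<ge> ereal (f m ^ m / 2)"
    unfolding eventually_sequentially by blast
  \<comment> \<open>Up to M the base is set to 0, and the claim is trivial as 0^n = 0 for n \<ge> 1.
    Beyond M the base is the n-th root of the bound for dimension n, with m = n - 1.\<close>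
  define \<delta> where "\<delta> n = (if n \<le> M then - B else (f (n - 1) ^ (n - 1) / 2) powr (1 / real n) - B)" for n
  have "(\<lambda>m. (f m ^ m / 2) powr (1 / real (Suc m)) - B) \<longlonglongrightarrow> 0"
    using tendsto_diff[OF lim tendsto_const[of B]] by simp
  moreover have "\<forall>\<^sub>F m in sequentially. (f m ^ m / 2) powr (1 / real (Suc m)) - B = \<delta> (Suc m)"
    using eventually_ge_at_top[of M] by eventually_elim (simp add: \<delta>_def)
  ultimately have "(\<lambda>m. \<delta> (Suc m)) \<longlonglongrightarrow> 0" by (rule Lim_transform_eventually)
  then have "\<delta> \<longlonglongrightarrow> 0" by (rule LIMSEQ_imp_Suc)
  moreover have "ereal ((B + \<delta> n) ^ n) \<le> ereal_of_enat (sphere_chromatic_number n r)" if n: "n \<ge> 1" for n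
  proof (cases "n \<le> M")
    case True
    have "(B + \<delta> n) ^ n = 0" using True n by (simp add: \<delta>_def)
    show ?thesis unfolding \<open>(B + \<delta> n) ^ n = 0\<close> by (simp add: zero_ereal_def[symmetric])
  next
    case False
    then obtain m where m: "n = Suc m" "m \<ge> M" by (cases n) auto
    have f0: "f m ^ m / 2 \<ge> 0" by (simp add: f_def binary_entropy_exp_def)
    have "(B + \<delta> n) ^ n = ((f m ^ m / 2) powr (1 / real (Suc m))) ^ Suc m" using m by (simp add: \<delta>_def)
    also have "\<dots> = f m ^ m / 2"
    proof (cases "f m ^ m / 2 = 0")
      case False
      with f0 have "f m ^ m / 2 > 0" by linarith
      moreover have "(z powr (1 / real (Suc m))) ^ Suc m = z" if "z > 0" for z :: real
        using powr_realpow[of "z powr (1 / real (Suc m))" "Suc m"] that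
        by (simp add: powr_powr del: of_nat_Suc power_Suc)
      ultimately show ?thesis by blast
    next
      case True
      show ?thesis unfolding True by simp
    qed
    finally have "(B + \<delta> n) ^ n = f m ^ m / 2" .
    then show ?thesis using M[OF m(2)] unfolding m(1) by (simp only:)
  qed
  ultimately show ?thesis
    unfolding B_def binary_entropy_exp_def a_def by (intro exI[of _ \<delta>]) (simp add: mult.assoc)
qed

end
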